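(* Let $\{X_n\}_{n\in\mathbb{Z}}$ be a real second-order stationary series with spectral density $$f_X(\lambda)=\begin{cases}(c_f^-+R_f^-(\lambda_0-\lambda))(\lambda_0-\lambda)^{-2d},&0<\lambda<\lambda_0,\\(c_f^++R_f^+(\lambda-\lambda_0))(\lambda-\lambda_0)^{-2d},&\lambda_0<\lambda<\pi,\end{cases}$$ where $\lambda_0\in(0,\pi)$, $d\in(0,1/2)$, $c_f^+>0$, $$c_f^-=0,\qquad R_f^-(x)=L_f^-\left(\frac1x\right)x^{2\varepsilon},\qquad R_f^+(x)=L_f^+\left(\frac1x\right)-c_f^+,$$ with $\varepsilon\in(0,d)$ and $L_f^-:(\frac1{\lambda_0},\infty)\to(0,\infty)$, $L_f^+:(\frac1{\pi-\lambda_0},\infty)\to(0,\infty)$ quasi-monotone slowly varying functions at $+\infty$, with $L_f^+(x)\to c_f^+$ as $x\to\infty$. Then the autocovariance function of $X$ satisfies $$\gamma_X(h)=\big(c_\gamma\cos(\lambda_0h+\phi)+R_\gamma(h)\big)h^{2d-1},\quad h\ge1,\qquad R_\gamma(h)\to0\ \text{ as }h\to\infty,$$ with $$c_\gamma=2\Gamma(1-2d)c_f^+,\qquad\phi=\left(\frac12-d\right)\pi .$$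
   Context: The spectral density is even on $(-\pi,\pi)$ and $\gamma_X(h)=\int_{-\pi}^{\pi}e^{ih\lambda}f_X(\lambda)\,d\lambda$. A slowly varying function $L:[0,\infty)\to(0,\infty)$ at infinity is called quasi-monotone if (i) it is of bounded variation on every compact subinterval of $[0,\infty)$, and (ii) for some $\delta>0$, $\int_0^xu^\delta|dL(u)|=O(x^\delta L(x))$ as $x\to\infty$. For a function on $(a,\infty)$ the same definition is used with $0$ replaced by $a$ (so that $L$ has bounded variation on $(a,x]$ for every $x>a$, and the integral is over $(a,x]$). *)

theory Defs
  imports "HOL-Probability.Probability" "HOL-Library.Landau_Symbols"
begin

subsection \<open>Bounded variation and the measure |dL|\<close>

definition variation_sums :: "real set \<Rightarrow> (real \<Rightarrow> real) \<Rightarrow> real set" where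
  "variation_sums S g =
     {(\<Sum>i<n. \<bar>g (p (Suc i)) - g (p i)\<bar>) | (n :: nat) (p :: nat \<Rightarrow> real).
        (\<forall>i\<le>n. p i \<in> S) \<and> (\<forall>i<n. p i \<le> p (Suc i))}"

definition has_bounded_variation :: "real set \<Rightarrow> (real \<Rightarrow> real) \<Rightarrow> bool" where
  "has_bounded_variation S g \<longleftrightarrow> bdd_above (variation_sums S g)"

definition total_variation :: "real set \<Rightarrow> (real \<Rightarrow> real) \<Rightarrow> real" where
  "total_variation S g = Sup (variation_sums S g)"

text \<open>
  The variation function of L on the interval from a (excluded) to t, extended by 0 to the
  left of a: the case distinction is needed because the supremum of the empty set of reals
  is unspecified.
\<close>

definition variation_function :: "real \<Rightarrow> (real \<Rightarrow> real) \<Rightarrow> real \<Rightarrow> real" where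
  "variation_function a L t = (if t \<le> a then 0 else total_variation {a<..t} L)"

text \<open>
  The measure |dL| on the half line to the right of a is the Lebesgue-Stieltjes measure of
  the variation function. L is not required to be right-continuous, whereas
  \<^const>\<open>interval_measure\<close> is only meaningful for right-continuous functions;
  hence the passage to right limits, which exist by monotonicity.
\<close>

definition variation_measure :: "real \<Rightarrow> (real \<Rightarrow> real) \<Rightarrow> real measure" where
  "variation_measure a L =
     interval_measure (\<lambda>x. Lim (at_right x) (variation_function a L))"


subsection \<open>Quasi-monotone slowly varying functions on a half line\<close>

text \<open>
  The functions below live on the open half line to the right of a (with a nonnegative);
  the values of L elsewhere are never used.
\<close>

definition slowly_varying :: "real \<Rightarrow> (real \<Rightarrow> real) \<Rightarrow> bool" where
  "slowly_varying a L \<longleftrightarrow>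
     L \<in> borel_measurable (restrict_space borel {a<..}) \<and>
     (\<forall>x>a. 0 < L x) \<and>
     (\<forall>t>0. ((\<lambda>x. L (t * x) / L x) \<longlongrightarrow> 1) at_top)"

definition quasi_monotone :: "real \<Rightarrow> (real \<Rightarrow> real) \<Rightarrow> bool" where
  "quasi_monotone a L \<longleftrightarrow>
     (\<forall>x>a. has_bounded_variation {a<..x} L) \<and>
     (\<exists>\<delta>>0. (\<lambda>x. LINT u:{a<..x}|variation_measure a L. u powr \<delta>)
               \<in> O[at_top](\<lambda>x. x powr \<delta> * L x))"


subsection \<open>Second-order stationary series\<close>

definition covariance :: "'a measure \<Rightarrow> ('a \<Rightarrow> real) \<Rightarrow> ('a \<Rightarrow> real) \<Rightarrow> real" where
  "covariance M Y Z =
     (LINT \<omega>|M. (Y \<omega> - (LINT \<omega>'|M. Y \<omega>')) * (Z \<omega> - (LINT \<omega>'|M. Z \<omega>')))"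

definition second_order_stationary :: "'a measure \<Rightarrow> (int \<Rightarrow> 'a \<Rightarrow> real) \<Rightarrow> bool" where
  "second_order_stationary M X \<longleftrightarrow>
     prob_space M \<and>
     (\<forall>n. X n \<in> borel_measurable M \<and> integrable M (\<lambda>\<omega>. (X n \<omega>)\<^sup>2)) \<and>
     (\<forall>m n. (LINT \<omega>|M. X m \<omega>) = (LINT \<omega>|M. X n \<omega>)) \<and>
     (\<forall>m n h. covariance M (X (m + h)) (X m) = covariance M (X (n + h)) (X n))"

definition autocovariance :: "'a measure \<Rightarrow> (int \<Rightarrow> 'a \<Rightarrow> real) \<Rightarrow> int \<Rightarrow> real" where
  "autocovariance M X h = covariance M (X h) (X 0)"

definition spectral_density :: "'a measure \<Rightarrow> (int \<Rightarrow> 'a \<Rightarrow> real) \<Rightarrow> (real \<Rightarrow> real) \<Rightarrow> bool" where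
  "spectral_density M X f \<longleftrightarrow>
     set_integrable lborel {-pi<..<pi} f \<and>
     (\<forall>x\<in>{-pi<..<pi}. 0 \<le> f x \<and> f (-x) = f x) \<and>
     (\<forall>h. complex_of_real (autocovariance M X h) =
        (LINT x:{-pi<..<pi}|lborel.
           exp (\<i> * of_int h * complex_of_real x) * complex_of_real (f x)))"

end

(*
  Splitting the cosine integral of f_X at lambda0 and measuring the distance y from lambda0 leaves
  three oscillatory integrals. The integral of cos (h y + theta) * y powr (-2 d) is computed by
  rotating the contour from the positive real to the positive imaginary axis, which produces
  Gamma (1 - 2 d) and the phase. The other two have a factor K y such as L (1 / y) - c with
  K y = o (y powr (-eta)), and should be of smaller order. Near 0, up to A / h, this follows from
  the size of K alone. On a dyadic block [x, 2 x], quasi-monotonicity bounds the variation of K,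
  so that K is a difference of two monotone functions, and the second mean value theorem gains a
  factor 1 / (h x) over the trivial bound; the block bounds sum to a geometric series dominated by
  its first term x = A / h. Let first h and then A tend to infinity.
*)
theory Submission
  imports Defs "HOL-Complex_Analysis.Complex_Analysis"
begin

subsection \<open>Oscillatory integrals with a factor of bounded variation\<close>

text \<open>Both remainders must be o(h powr (2 d - 1)), yet to the left of the singularity the
  slowly varying factor may tend to infinity. The estimates therefore carry two exponents: a weight
  y powr p and a size y powr (-\<eta>) of the factor K. Only \<eta> - p = 2 d enters the order, so
  the left remainder (p = 2 \<epsilon> - 2 d, \<eta> = 2 \<epsilon>) and the right one (p = -2 d,
  \<eta> = 0) are treated alike. The bound \<eta> - p < 1 makes the part near 0 integrable; \<eta> -
  p > 0 makes the dyadic sums geometric with ratio below 1. Smallness has two sources: near 0 the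
  limit of K, beyond A / h the factor A powr (-2 d). Hence on the blocks a mere O-bound suffices,
  which is what quasi-monotonicity provides. Two obstacles shape that bound. It speaks of a measure
  built from right limits of the variation function, which have to be sandwiched between values of
  the variation function at nearby points. And it holds only near infinity, while the blocks reach
  up to the far endpoint, where bounded variation takes over.\<close>

lemma integral_monotone_weight_bound:
  fixes f u :: "real \<Rightarrow> real"
  assumes f: "f integrable_on {s..t}" and "s \<le> t"
    and u: "\<And>x y. \<lbrakk>s \<le> x; x \<le> y; y \<le> t\<rbrakk> \<Longrightarrow> u y \<le> u x"
    and B: "\<And>c. c \<in> {s..t} \<Longrightarrow> \<bar>integral {c..t} f\<bar> \<le> B"
  shows "(\<lambda>x. (u x - u s) * f x) integrable_on {s..t}"
    and "\<bar>integral {s..t} (\<lambda>x. (u x - u s) * f x)\<bar> \<le> (u s - u t) * B"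
proof -
  \<comment> \<open>Measured from its value at \<open>s\<close>, the factor becomes increasing and
    vanishes at \<open>s\<close>. The first of the two mean value terms disappears, and only the
    drop of \<open>u\<close> remains, whatever the size of \<open>u\<close> itself.\<close>
  obtain c where c: "c \<in> {s..t}"
    and I: "((\<lambda>x. (u s - u x) * f x) has_integral
      ((u s - u s) * integral {s..c} f + (u s - u t) * integral {c..t} f)) {s..t}"
    by (rule second_mean_value_theorem_full[OF f \<open>s \<le> t\<close>, of "\<lambda>x. u s - u x"]) (use u in auto)
  have J: "((\<lambda>x. (u x - u s) * f x) has_integral - ((u s - u t) * integral {c..t} f)) {s..t}"
    using has_integral_neg[OF I] by (simp add: algebra_simps)
  show "(\<lambda>x. (u x - u s) * f x) integrable_on {s..t}"
    using J by blast
  have "u s - u t \<ge> 0"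
    using u[of s t] \<open>s \<le> t\<close> by simp
  then show "\<bar>integral {s..t} (\<lambda>x. (u x - u s) * f x)\<bar> \<le> (u s - u t) * B"
    using B[OF c] integral_unique[OF J] by (simp add: abs_mult mult_left_mono)
qed

lemma integral_cos_bound:
  fixes h \<theta> :: real
  assumes "h > 0" "s \<le> t"
  shows "\<bar>integral {s..t} (\<lambda>y. cos (h * y + \<theta>))\<bar> \<le> 2 / h"
proof -
  have "((\<lambda>y. cos (h * y + \<theta>)) has_integral (sin (h * t + \<theta>) / h - sin (h * s + \<theta>) / h)) {s..t}"
    by (rule fundamental_theorem_of_calculus)
       (use assms in \<open>auto intro!: derivative_eq_intros simp flip: has_real_derivative_iff_has_vector_derivative\<close>)
  then have "\<bar>integral {s..t} (\<lambda>y. cos (h * y + \<theta>))\<bar> = \<bar>sin (h * t + \<theta>) - sin (h * s + \<theta>)\<bar> / h"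
    using assms by (simp add: integral_unique diff_divide_distrib[symmetric])
  also have "\<dots> \<le> 2 / h"
    using abs_sin_le_one[of "h * t + \<theta>"] abs_sin_le_one[of "h * s + \<theta>"] assms
    by (intro divide_right_mono) linarith+
  finally show ?thesis .
qed

text \<open>The mean value bound with the decreasing power as factor, after splitting off its value
  at \<open>s\<close>. Only the left endpoint enters, so the bound is uniform in
  \<open>t\<close>.\<close>

lemma integral_cos_powr_bound:
  fixes h \<theta> p :: real
  assumes "h > 0" "0 < s" "s \<le> t" "p \<le> 0"
  shows "(\<lambda>y. cos (h * y + \<theta>) * y powr p) integrable_on {s..t}"
    and "\<bar>integral {s..t} (\<lambda>y. cos (h * y + \<theta>) * y powr p)\<bar> \<le> 4 * s powr p / h"
proof -
  let ?c = "\<lambda>y. cos (h * y + \<theta>)"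
  show int: "(\<lambda>y. ?c y * y powr p) integrable_on {s..t}"
    by (rule integrable_continuous_interval) (use assms in \<open>auto intro!: continuous_intros\<close>)
  have cint: "?c integrable_on {s..t}"
    by (rule integrable_continuous_interval) (auto intro!: continuous_intros)
  have dec: "y powr p \<le> x powr p" if "s \<le> x" "x \<le> y" for x y
    using that assms by (intro powr_mono2') auto
  have bnd: "\<bar>integral {s..t} (\<lambda>y. (y powr p - s powr p) * ?c y)\<bar> \<le> (s powr p - t powr p) * (2 / h)"
    by (rule integral_monotone_weight_bound(2)[OF cint])
       (use assms dec integral_cos_bound[of h] in auto)
  have int2: "(\<lambda>y. (y powr p - s powr p) * ?c y) integrable_on {s..t}"
    by (rule integral_monotone_weight_bound(1)[OF cint, of _ "2 / h"])
       (use assms dec integral_cos_bound[of h] in auto)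
  have "integral {s..t} (\<lambda>y. ?c y * y powr p)
      = integral {s..t} (\<lambda>y. (y powr p - s powr p) * ?c y + s powr p * ?c y)"
    by (simp add: algebra_simps)
  also have "\<dots> = integral {s..t} (\<lambda>y. (y powr p - s powr p) * ?c y) + s powr p * integral {s..t} ?c"
    using int2 cint by (subst Henstock_Kurzweil_Integration.integral_add)
      (auto intro: integrable_on_mult_right)
  also have "\<bar>\<dots>\<bar> \<le> (s powr p - t powr p) * (2 / h) + s powr p * (2 / h)"
  proof -
    have "\<bar>s powr p * integral {s..t} ?c\<bar> \<le> s powr p * (2 / h)"
      unfolding abs_mult by (intro mult_mono) (use integral_cos_bound[of h s t \<theta>] assms in auto)
    with bnd show ?thesis by linarith
  qed
  also have "\<dots> \<le> 4 * s powr p / h"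
    using assms by (simp add: field_simps)
  finally show "\<bar>integral {s..t} (\<lambda>y. ?c y * y powr p)\<bar> \<le> 4 * s powr p / h" .
qed

text \<open>Writing \<open>K\<close> as \<open>(U - U s) - (W - W s) + K s\<close> brings in only
  the drops of \<open>U\<close> and \<open>W\<close> across the block; the variation function, which
  later takes the place of \<open>U\<close>, may be far larger than \<open>K\<close>. Three terms,
  each at most \<open>B\<close> times \<open>4 * s powr p / h\<close>, give the constant 12.\<close>

lemma oscillatory_block_bound:
  fixes K U W :: "real \<Rightarrow> real"
  assumes "h > 0" "0 < s" "s \<le> t" "p \<le> 0"
    and K: "\<And>y. y \<in> {s..t} \<Longrightarrow> K y = U y - W y"
    and U: "\<And>x y. \<lbrakk>s \<le> x; x \<le> y; y \<le> t\<rbrakk> \<Longrightarrow> U y \<le> U x"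
    and W: "\<And>x y. \<lbrakk>s \<le> x; x \<le> y; y \<le> t\<rbrakk> \<Longrightarrow> W y \<le> W x"
    and "\<bar>K s\<bar> \<le> B" "U s - U t \<le> B" "W s - W t \<le> B"
  shows "(\<lambda>y. cos (h * y + \<theta>) * K y * y powr p) integrable_on {s..t}"
    and "\<bar>integral {s..t} (\<lambda>y. cos (h * y + \<theta>) * K y * y powr p)\<bar> \<le> 12 * B * s powr p / h"
proof -
  let ?f = "\<lambda>y. cos (h * y + \<theta>) * y powr p"
  let ?u = "\<lambda>y. (U y - U s) * ?f y" and ?w = "\<lambda>y. (W y - W s) * ?f y"
  let ?M = "4 * s powr p / h"
  have M: "?M \<ge> 0"
    using assms by simp
  have fint: "?f integrable_on {s..t}"
    using integral_cos_powr_bound(1) assms by blast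
  have fb: "\<bar>integral {c..t} ?f\<bar> \<le> ?M" if "c \<in> {s..t}" for c
  proof -
    have "\<bar>integral {c..t} ?f\<bar> \<le> 4 * c powr p / h"
      using that assms by (intro integral_cos_powr_bound) auto
    also have "\<dots> \<le> ?M"
      using that assms by (intro divide_right_mono mult_left_mono powr_mono2') auto
    finally show ?thesis .
  qed
  note u = integral_monotone_weight_bound[OF fint \<open>s \<le> t\<close>, of U, OF U fb]
  note w = integral_monotone_weight_bound[OF fint \<open>s \<le> t\<close>, of W, OF W fb]
  have eq: "cos (h * y + \<theta>) * K y * y powr p = ?u y - ?w y + K s * ?f y" if "y \<in> {s..t}" for y
  proof -
    have "K y = U y - W y" "K s = U s - W s"
      using K that assms by auto
    then show ?thesis by (simp only:) (simp add: algebra_simps)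
  qed
  have I: "((\<lambda>y. ?u y - ?w y + K s * ?f y) has_integral
      (integral {s..t} ?u - integral {s..t} ?w + K s * integral {s..t} ?f)) {s..t}"
    by (intro has_integral_add has_integral_diff has_integral_mult_right integrable_integral u w fint)
      auto
  then have J: "((\<lambda>y. cos (h * y + \<theta>) * K y * y powr p) has_integral
      (integral {s..t} ?u - integral {s..t} ?w + K s * integral {s..t} ?f)) {s..t}"
    using eq by (subst has_integral_cong) auto
  show "(\<lambda>y. cos (h * y + \<theta>) * K y * y powr p) integrable_on {s..t}"
    using J by blast
  have "\<bar>integral {s..t} ?u\<bar> \<le> B * ?M"
    using u(2) mult_right_mono[OF \<open>U s - U t \<le> B\<close> M] by linarith
  moreover have "\<bar>integral {s..t} ?w\<bar> \<le> B * ?M"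
    using w(2) mult_right_mono[OF \<open>W s - W t \<le> B\<close> M] by linarith
  moreover have "\<bar>K s * integral {s..t} ?f\<bar> \<le> B * ?M"
    unfolding abs_mult by (intro mult_mono fb) (use assms in auto)
  ultimately have "\<bar>integral {s..t} (\<lambda>y. cos (h * y + \<theta>) * K y * y powr p)\<bar> \<le> 3 * (B * ?M)"
    unfolding integral_unique[OF J] by linarith
  then show "\<bar>integral {s..t} (\<lambda>y. cos (h * y + \<theta>) * K y * y powr p)\<bar> \<le> 12 * B * s powr p / h"
    by simp
qed

text \<open>Peeling off the block from x to 2 x and doubling x shrinks the block bound by a fixed
  ratio, so the constant depends neither on \<open>t\<close> nor on \<open>h\<close>. Endpoints stay
  below \<open>b\<close>, since the hypotheses control \<open>K\<close> only there.\<close>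

lemma oscillatory_tail_bound:
  fixes K U W :: "real \<Rightarrow> real"
  assumes p: "p \<le> 0" and \<alpha>: "\<eta> - p > 0" and "C \<ge> 0"
    and K: "\<And>y. 0 < y \<Longrightarrow> y < b \<Longrightarrow> K y = U y - W y"
    and U: "\<And>x y. \<lbrakk>0 < x; x \<le> y; y < b\<rbrakk> \<Longrightarrow> U y \<le> U x"
    and W: "\<And>x y. \<lbrakk>0 < x; x \<le> y; y < b\<rbrakk> \<Longrightarrow> W y \<le> W x"
    and KB: "\<And>y. 0 < y \<Longrightarrow> y < b \<Longrightarrow> \<bar>K y\<bar> \<le> C * y powr (-\<eta>)"
    and UB: "\<And>x y. \<lbrakk>0 < x; x \<le> y; y \<le> 2 * x; y < b\<rbrakk> \<Longrightarrow> U x - U y \<le> C * x powr (-\<eta>)"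
    and WB: "\<And>x y. \<lbrakk>0 < x; x \<le> y; y \<le> 2 * x; y < b\<rbrakk> \<Longrightarrow> W x - W y \<le> C * x powr (-\<eta>)"
  obtains D where "D \<ge> 0"
    "\<And>h \<theta> x t. \<lbrakk>h > 0; 0 < x; x \<le> t; t < b\<rbrakk> \<Longrightarrow>
      (\<lambda>y. cos (h * y + \<theta>) * K y * y powr p) integrable_on {x..t} \<and>
      \<bar>integral {x..t} (\<lambda>y. cos (h * y + \<theta>) * K y * y powr p)\<bar> \<le> D * x powr (p - \<eta>) / h"
proof -
  define q where "q = 2 powr (p - \<eta>)"
  have q: "0 < q" "q < 1"
    using \<alpha> by (auto simp: q_def powr_less_one)
  \<comment> \<open>the sum of the geometric series of the dyadic block bounds\<close>
  define D where "D = 12 * C / (1 - q)"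
  \<comment> \<open>\<open>D\<close> is the fixed point of the recursion behind the induction: the
    first block costs \<open>12 * C\<close>, the rest \<open>q\<close> times the claimed
    constant.\<close>
  have DE: "12 * C + D * q = D"
    using q by (simp add: D_def field_simps)
  have D0: "D \<ge> 0"
    using q \<open>C \<ge> 0\<close> by (simp add: D_def)
  have ED: "12 * C \<le> D"
    using DE D0 q by (smt (verit) mult_nonneg_nonneg)
  have block: "(\<lambda>y. cos (h * y + \<theta>) * K y * y powr p) integrable_on {x..t} \<and>
      \<bar>integral {x..t} (\<lambda>y. cos (h * y + \<theta>) * K y * y powr p)\<bar> \<le> 12 * C * x powr (p - \<eta>) / h"
    if "h > 0" "0 < x" "x \<le> t" "t < b" "t \<le> 2 * x" for h \<theta> x t
  proof -
    have "12 * (C * x powr (-\<eta>)) * x powr p / h = 12 * C * x powr (p - \<eta>) / h"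
      using that by (simp add: powr_diff powr_minus field_simps)
    with oscillatory_block_bound[of h x t p K U W "C * x powr (-\<eta>)" \<theta>]
    show ?thesis
      using that p K U W KB UB WB by auto
  qed
  have main: "(\<lambda>y. cos (h * y + \<theta>) * K y * y powr p) integrable_on {x..t} \<and>
      \<bar>integral {x..t} (\<lambda>y. cos (h * y + \<theta>) * K y * y powr p)\<bar> \<le> D * x powr (p - \<eta>) / h"
    if "h > 0" "0 < x" "x \<le> t" "t < b" "t \<le> 2 ^ n * x" for h \<theta> x t n
    using that
  proof (induction n arbitrary: x)
    case 0
    then have "x = t" by simp
    then show ?case
      using 0 D0 integrable_on_refl[of _ t] by auto
  next
    case (Suc n)
    let ?f = "\<lambda>y. cos (h * y + \<theta>) * K y * y powr p"
    show ?case
    proof (cases "t \<le> 2 * x")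
      case True
      have "12 * C * x powr (p - \<eta>) / h \<le> D * x powr (p - \<eta>) / h"
        using ED Suc.prems by (intro divide_right_mono mult_right_mono) auto
      with block[OF Suc.prems(1-4) True] show ?thesis by (meson order_trans)
    next
      case False
      have b1: "?f integrable_on {x..2*x}" "\<bar>integral {x..2*x} ?f\<bar> \<le> 12 * C * x powr (p - \<eta>) / h"
        using block[of h x "2 * x"] False Suc.prems by auto
      have b2: "?f integrable_on {2*x..t}" "\<bar>integral {2*x..t} ?f\<bar> \<le> D * (2 * x) powr (p - \<eta>) / h"
        using Suc.IH[of "2 * x"] False Suc.prems by (auto simp: mult_ac)
      have i: "?f integrable_on {x..t}"
        using Henstock_Kurzweil_Integration.integrable_combine[of x "2*x" t ?f] b1 b2 False Suc.prems by auto
      have "integral {x..t} ?f = integral {x..2*x} ?f + integral {2*x..t} ?f"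
        using Henstock_Kurzweil_Integration.integral_combine[of x "2*x" t ?f] i False Suc.prems by auto
      moreover have "12 * C * x powr (p - \<eta>) / h + D * (2 * x) powr (p - \<eta>) / h
          = (12 * C + D * q) * x powr (p - \<eta>) / h"
        using Suc.prems by (simp add: q_def powr_mult add_divide_distrib distrib_right)
      ultimately show ?thesis
        using b1 b2 i DE by auto
    qed
  qed
  show ?thesis
  proof (rule that[OF D0])
    fix h \<theta> x t :: real
    assume *: "h > 0" "0 < x" "x \<le> t" "t < b"
    obtain n where "t / x < 2 ^ n"
      using real_arch_pow[of 2 "t / x"] by auto
    then have "t \<le> 2 ^ n * x"
      using * by (simp add: field_simps)
    with main[OF *] show "(\<lambda>y. cos (h * y + \<theta>) * K y * y powr p) integrable_on {x..t} \<and>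
      \<bar>integral {x..t} (\<lambda>y. cos (h * y + \<theta>) * K y * y powr p)\<bar> \<le> D * x powr (p - \<eta>) / h" by blast
  qed
qed

text \<open>The order is the one predicted by the substitution s = n y. The phase may vary with
  \<open>n\<close> because all estimates are uniform in it, as the phases
  \<open>real n * lambda0\<close> require.\<close>

lemma oscillatory_integral_little_o:
  fixes K U W :: "real \<Rightarrow> real" and \<theta> :: "nat \<Rightarrow> real"
  assumes p: "p \<le> 0" and \<alpha>: "0 < \<eta> - p" "\<eta> - p < 1" and "C \<ge> 0" "b > 0"
    and K: "\<And>y. 0 < y \<Longrightarrow> y < b \<Longrightarrow> K y = U y - W y"
    and U: "\<And>x y. \<lbrakk>0 < x; x \<le> y; y < b\<rbrakk> \<Longrightarrow> U y \<le> U x"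
    and W: "\<And>x y. \<lbrakk>0 < x; x \<le> y; y < b\<rbrakk> \<Longrightarrow> W y \<le> W x"
    and KB: "\<And>y. 0 < y \<Longrightarrow> y < b \<Longrightarrow> \<bar>K y\<bar> \<le> C * y powr (-\<eta>)"
    and UB: "\<And>x y. \<lbrakk>0 < x; x \<le> y; y \<le> 2 * x; y < b\<rbrakk> \<Longrightarrow> U x - U y \<le> C * x powr (-\<eta>)"
    and WB: "\<And>x y. \<lbrakk>0 < x; x \<le> y; y \<le> 2 * x; y < b\<rbrakk> \<Longrightarrow> W x - W y \<le> C * x powr (-\<eta>)"
    and int: "\<And>h \<theta>. (\<lambda>y. cos (h * y + \<theta>) * K y * y powr p) integrable_on {0..b}"
    and lim: "((\<lambda>y. K y * y powr \<eta>) \<longlongrightarrow> 0) (at_right 0)"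
  shows "(\<lambda>n. real n powr (1 + p - \<eta>) *
           integral {0..b} (\<lambda>y. cos (real n * y + \<theta> n) * K y * y powr p)) \<longlonglongrightarrow> 0"
proof -
  define \<alpha> where "\<alpha> = \<eta> - p"
  have \<alpha>01: "0 < \<alpha>" "\<alpha> < 1"
    using \<alpha> by (auto simp: \<alpha>_def)
  obtain D where "D \<ge> 0"
    and D: "\<And>h \<theta> x t. \<lbrakk>h > 0; 0 < x; x \<le> t; t < b\<rbrakk> \<Longrightarrow>
      (\<lambda>y. cos (h * y + \<theta>) * K y * y powr p) integrable_on {x..t} \<and>
      \<bar>integral {x..t} (\<lambda>y. cos (h * y + \<theta>) * K y * y powr p)\<bar> \<le> D * x powr (p - \<eta>) / h"
    by (rule oscillatory_tail_bound[of p \<eta> C b K U W])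
       (use p \<alpha> \<open>C \<ge> 0\<close> K U W KB UB WB in auto)
  have bound: "\<bar>integral {0..b} (\<lambda>y. cos (h * y + \<theta>) * K y * y powr p)\<bar>
      \<le> \<kappa> * (x powr (1 - \<alpha>) / (1 - \<alpha>)) + D * x powr (-\<alpha>) / h"
    if "h > 0" "0 < x" "x < b" and \<kappa>: "\<And>y. 0 < y \<Longrightarrow> y \<le> x \<Longrightarrow> \<bar>K y * y powr \<eta>\<bar> \<le> \<kappa>" for h \<theta> x \<kappa>
  proof -
    let ?f = "\<lambda>y. cos (h * y + \<theta>) * K y * y powr p"
    have i0: "?f integrable_on {0..x}" and i1: "?f integrable_on {x..b}"
      using integrable_subinterval_real[OF int[of h \<theta>]] that by auto
    have P: "((\<lambda>y. \<kappa> * y powr (-\<alpha>)) has_integral \<kappa> * (x powr (1 - \<alpha>) / (1 - \<alpha>))) {0..x}"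
      using has_integral_mult_right[OF has_integral_powr_from_0[of "-\<alpha>" x], of \<kappa>] that \<alpha>01
      by simp
    \<comment> \<open>At y = 0 both sides vanish, since \<open>0 powr\<close> any exponent is
      0.\<close>
    have "\<bar>?f y\<bar> \<le> \<kappa> * y powr (-\<alpha>)" if y: "y \<in> {0..x}" for y
    proof (cases "y = 0")
      case False
      then have "y > 0" using y by auto
      have "\<bar>?f y\<bar> \<le> \<bar>K y\<bar> * y powr p"
        using abs_cos_le_one[of "h * y + \<theta>"] by (simp add: abs_mult mult_left_le_one_le mult.assoc)
      also have "\<dots> = \<bar>K y * y powr \<eta>\<bar> * y powr (-\<alpha>)"
        using \<open>y > 0\<close> by (simp add: \<alpha>_def abs_mult powr_diff)
      also have "\<dots> \<le> \<kappa> * y powr (-\<alpha>)"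
        using \<kappa>[of y] \<open>y > 0\<close> y by (intro mult_right_mono) auto
      finally show ?thesis .
    qed simp
    then have "norm (integral {0..x} ?f) \<le> integral {0..x} (\<lambda>y. \<kappa> * y powr (-\<alpha>))"
      using i0 P by (intro integral_norm_bound_integral) auto
    then have near: "\<bar>integral {0..x} ?f\<bar> \<le> \<kappa> * (x powr (1 - \<alpha>) / (1 - \<alpha>))"
      by (simp only: real_norm_def integral_unique[OF P])
    \<comment> \<open>The tail bound is available only for t < b; continuity of the indefinite
      integral carries it to \<open>b\<close>.\<close>
    have "((\<lambda>t. integral {x..t} ?f) \<longlongrightarrow> integral {x..b} ?f) (at b within {x..b})"
      using indefinite_integral_continuous_1[OF i1] that by (auto simp: continuous_on_def)
    then have "((\<lambda>t. \<bar>integral {x..t} ?f\<bar>) \<longlongrightarrow> \<bar>integral {x..b} ?f\<bar>) (at_left b)"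
      using \<open>x < b\<close> by (simp add: at_within_Icc_at_left tendsto_rabs)
    moreover have "\<forall>\<^sub>F t in at_left b. \<bar>integral {x..t} ?f\<bar> \<le> D * x powr (-\<alpha>) / h"
      using eventually_at_left_real[OF \<open>x < b\<close>] 
    proof eventually_elim
      case (elim t)
      then show ?case using D[of h x t \<theta>] that by (simp add: \<alpha>_def)
    qed
    ultimately have "\<bar>integral {x..b} ?f\<bar> \<le> D * x powr (-\<alpha>) / h"
      by (rule tendsto_upperbound) simp
    moreover have "integral {0..b} ?f = integral {0..x} ?f + integral {x..b} ?f"
      using Henstock_Kurzweil_Integration.integral_combine[of 0 x b ?f] int that by auto
    ultimately show ?thesis using near by linarith
  qed
  show ?thesis
  proof (rule tendstoI)
    fix e :: real assume "e > 0"
    have "((\<lambda>A. D * A powr (-\<alpha>)) \<longlongrightarrow> D * 0) at_top"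
      by (intro tendsto_mult_left tendsto_neg_powr filterlim_ident) (use \<alpha>01 in auto)
    then have "\<forall>\<^sub>F A in at_top. D * A powr (-\<alpha>) < e / 2"
      using \<open>e > 0\<close> by (intro order_tendstoD) auto
    then obtain A where A: "A > 0" "D * A powr (-\<alpha>) < e / 2"
      using eventually_happens[OF eventually_conj[OF _ eventually_gt_at_top[of 0]]] by force
    \<comment> \<open>\<open>A\<close> is fixed by \<open>D\<close> and \<open>e\<close> alone, so
      \<kappa> may depend on it. Its value makes the scaled bound for the part near 0 equal to
      \<open>e / 4\<close>.\<close>
    define \<kappa> where "\<kappa> = e * (1 - \<alpha>) / (4 * A powr (1 - \<alpha>))"
    have "\<kappa> > 0"
      using \<alpha>01 A \<open>e > 0\<close> by (simp add: \<kappa>_def)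
    have "\<forall>\<^sub>F y in at_right 0. \<bar>K y * y powr \<eta>\<bar> < \<kappa>"
      using tendstoD[OF lim \<open>\<kappa> > 0\<close>] by simp
    then obtain \<delta> where "\<delta> > 0" and \<delta>: "\<And>y. 0 < y \<Longrightarrow> y < \<delta> \<Longrightarrow> \<bar>K y * y powr \<eta>\<bar> < \<kappa>"
      by (auto simp: eventually_at_right_field)
    have "(\<lambda>n. A / real n) \<longlonglongrightarrow> 0"
      by (rule lim_const_over_n)
    then have "\<forall>\<^sub>F n in sequentially. A / real n < min \<delta> b"
      using \<open>\<delta> > 0\<close> \<open>b > 0\<close> by (intro order_tendstoD) auto
    then show "\<forall>\<^sub>F n in sequentially. dist (real n powr (1 + p - \<eta>) *
           integral {0..b} (\<lambda>y. cos (real n * y + \<theta> n) * K y * y powr p)) 0 < e"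
      using eventually_gt_at_top[of 0]
    proof eventually_elim
      case (elim n)
      define x where "x = A / real n"
      have n: "real n > 0" and x: "0 < x" "x < \<delta>" "x < b"
        using elim A by (auto simp: x_def)
      have "\<bar>integral {0..b} (\<lambda>y. cos (real n * y + \<theta> n) * K y * y powr p)\<bar>
          \<le> \<kappa> * (x powr (1 - \<alpha>) / (1 - \<alpha>)) + D * x powr (-\<alpha>) / real n"
        using x \<delta> n by (intro bound) (auto intro: less_imp_le)
      then have "real n powr (1 - \<alpha>) * \<bar>integral {0..b} (\<lambda>y. cos (real n * y + \<theta> n) * K y * y powr p)\<bar>
          \<le> real n powr (1 - \<alpha>) * (\<kappa> * (x powr (1 - \<alpha>) / (1 - \<alpha>)) + D * x powr (-\<alpha>) / real n)"
        by (intro mult_left_mono) auto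
      also have "\<dots> = \<kappa> * (A powr (1 - \<alpha>) / (1 - \<alpha>)) + D * A powr (-\<alpha>)"
      proof -
        have "real n powr (1 - \<alpha>) * x powr (1 - \<alpha>) = A powr (1 - \<alpha>)"
          using n A by (simp add: x_def flip: powr_mult)
        moreover have "real n powr (1 - \<alpha>) * (x powr (-\<alpha>) / real n) = A powr (-\<alpha>)"
        proof -
          have "real n powr (1 - \<alpha>) / real n = real n powr (-\<alpha>)"
            using n by (simp add: powr_diff powr_minus field_simps)
          then have "real n powr (1 - \<alpha>) * (x powr (-\<alpha>) / real n) = real n powr (-\<alpha>) * x powr (-\<alpha>)"
            by (metis times_divide_eq_left times_divide_eq_right)
          also have "\<dots> = A powr (-\<alpha>)"
            using n A by (simp add: x_def flip: powr_mult)
          finally show ?thesis .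
        qed
        ultimately show ?thesis
          by (simp add: distrib_left mult_ac times_divide_eq_right)
             (metis mult.left_commute times_divide_eq_right)
      qed
      also have "\<kappa> * (A powr (1 - \<alpha>) / (1 - \<alpha>)) = e / 4"
        using \<alpha>01 A by (simp add: \<kappa>_def field_simps)
      finally have "real n powr (1 - \<alpha>) *
          \<bar>integral {0..b} (\<lambda>y. cos (real n * y + \<theta> n) * K y * y powr p)\<bar> < e"
        using A \<open>e > 0\<close> by linarith
      then show ?case
        by (simp add: abs_mult \<alpha>_def algebra_simps)
    qed
  qed
qed

subsection \<open>The Fourier transform of a power\<close>

text \<open>The partial integrals increase and are bounded by \<open>l\<close>, so they converge to
  their supremum. Monotone convergence shows that this supremum is also an integral over the half
  line, and uniqueness identifies it with \<open>l\<close>.\<close>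

lemma integral_tendsto_of_has_integral_Ici:
  fixes h :: "real \<Rightarrow> real"
  assumes h: "(h has_integral l) {a..}" and nonneg: "\<And>y. y \<ge> a \<Longrightarrow> h y \<ge> 0"
  shows "((\<lambda>y. integral {a..y} h) \<longlongrightarrow> l) at_top"
proof -
  have int: "h integrable_on {a..y}" for y
    by (rule integrable_on_subinterval[of h "{a..}"]) (use h in auto)
  define g where "g = (\<lambda>y. integral {a..y} h)"
  have "mono g"
    unfolding g_def by (intro monoI integral_subset_le) (use int nonneg in auto)
  have gl: "g y \<le> l" for y
    unfolding g_def using integral_subset_le[of "{a..y}" "{a..}" h] int nonneg h
    by (auto simp: integral_unique has_integral_integrable)
  have bdd: "bdd_above (range g)"
    by (rule bdd_aboveI2) (rule gl)
  have lim: "(g \<longlongrightarrow> (SUP y. g y)) at_top"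
  proof (intro order_tendstoI)
    fix c assume "c < (SUP y. g y)"
    then obtain y where "c < g y"
      using bdd by (auto simp: less_cSUP_iff)
    then show "\<forall>\<^sub>F x in at_top. c < g x"
      by (intro eventually_at_top_linorderI[of y]) (rule less_le_trans[OF _ monoD[OF \<open>mono g\<close>]])
  next
    fix c assume "(SUP y. g y) < c"
    then show "\<forall>\<^sub>F x in at_top. g x < c"
      by (intro always_eventually allI le_less_trans[OF cSUP_upper[OF UNIV_I bdd]])
  qed
  have "(h has_integral (SUP y. g y)) {a..}"
    by (rule has_integral_to_inf[OF int _ nonneg]) (use lim in \<open>simp only: g_def\<close>)
  then have "(SUP y. g y) = l"
    using h has_integral_unique by blast
  then show ?thesis
    using lim unfolding g_def by simp
qed

section \<open>The Gamma integral and the rotated contour\<close>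

lemma Gamma_real_limit:
  fixes s :: real
  assumes "s > 0"
  shows "((\<lambda>T. integral {0..T} (\<lambda>t. exp (-t) * t powr (s - 1))) \<longlongrightarrow> Gamma s) at_top"
  using integral_tendsto_of_has_integral_Ici[OF Gamma_integral_real[OF assms]]
  by (simp add: exp_minus divide_inverse mult.commute)

text \<open>The half plane is convex, avoids 0 and the branch cut of the power, and contains both
  positive half-axes and the segments joining them. A single primitive on it reduces the contour
  rotation to the fundamental theorem of calculus along straight lines.\<close>

lemma exp_powr_primitive:
  fixes p :: real
  obtains F where
    "\<And>z. Re z + Im z > 0 \<Longrightarrow> (F has_field_derivative exp (\<i> * z) * z powr complex_of_real p) (at z)"
proof -
  let ?S = "{z :: complex. Re z + Im z > 0}"
  have S: "?S = {z. (1 + \<i>) \<bullet> z > 0}"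
    by (auto simp: inner_complex_def)
  have "open ?S" "convex ?S"
    unfolding S by (rule open_halfspace_gt, rule convex_halfspace_gt)
  moreover have "(\<lambda>z. exp (\<i> * z) * z powr complex_of_real p) holomorphic_on ?S"
    by (intro holomorphic_intros) (auto simp: complex_nonpos_Reals_iff)
  ultimately obtain F where F:
    "\<And>z. z \<in> ?S \<Longrightarrow> (F has_field_derivative exp (\<i> * z) * z powr complex_of_real p) (at z within ?S)"
    using holomorphic_convex_primitive'[of ?S] by blast
  show ?thesis
  proof (rule that)
    fix z :: complex assume "Re z + Im z > 0"
    then have z: "z \<in> ?S" by simp
    show "(F has_field_derivative exp (\<i> * z) * z powr complex_of_real p) (at z)"
      using F[OF z] unfolding at_within_open[OF z \<open>open ?S\<close>] .
  qed
qed

lemma ii_powr_real: "\<i> powr complex_of_real p = exp (\<i> * of_real (p * pi / 2))"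
proof -
  have "complex_of_real p * Ln \<i> = \<i> * of_real (p * pi / 2)"
    by simp
  then show ?thesis by (simp only: powr_def) simp
qed

context
  fixes F :: "complex \<Rightarrow> complex" and p :: real
  assumes F: "\<And>z. Re z + Im z > 0 \<Longrightarrow>
      (F has_field_derivative exp (\<i> * z) * z powr complex_of_real p) (at z)"
begin

lemma primitive_real_axis:
  assumes "0 < \<delta>" "\<delta> \<le> T"
  shows "((\<lambda>t. exp (\<i> * of_real t) * of_real (t powr p)) has_integral (F (of_real T) - F (of_real \<delta>))) {\<delta>..T}"
proof (rule fundamental_theorem_of_calculus[OF \<open>\<delta> \<le> T\<close>])
  fix t assume t: "t \<in> {\<delta>..T}"
  then have "((\<lambda>t. F (of_real t)) has_vector_derivative
      exp (\<i> * of_real t) * of_real t powr complex_of_real p) (at t within {\<delta>..T})"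
    using assms by (intro has_vector_derivative_real_field F) simp
  then show "((\<lambda>t. F (of_real t)) has_vector_derivative
      exp (\<i> * of_real t) * of_real (t powr p)) (at t within {\<delta>..T})"
    using t assms by (simp add: powr_of_real)
qed

text \<open>This is where the phase originates: at z = \<i> t the power contributes
  \<open>\<i> powr p\<close> and dz another factor \<i>, while exp (\<i> z) turns into the decaying
  exp (-t) of the Gamma integral.\<close>

lemma primitive_imaginary_axis:
  assumes "0 < \<delta>" "\<delta> \<le> T"
  shows "((\<lambda>t. exp (\<i> * of_real ((p + 1) * pi / 2)) * of_real (exp (-t) * t powr p))
           has_integral (F (\<i> * of_real T) - F (\<i> * of_real \<delta>))) {\<delta>..T}"
proof (rule fundamental_theorem_of_calculus[OF \<open>\<delta> \<le> T\<close>])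
  fix t assume t: "t \<in> {\<delta>..T}"
  let ?g = "exp (\<i> * (\<i> * of_real t)) * (\<i> * of_real t) powr complex_of_real p"
  have "((\<lambda>z. F (\<i> * z)) has_field_derivative ?g * \<i>) (at (of_real t))"
  proof (rule DERIV_chain2[OF F])
    show "((*) \<i> has_field_derivative \<i>) (at (of_real t))"
      by (rule DERIV_cmult_Id)
  qed (use t assms in simp)
  then have D: "((\<lambda>t. F (\<i> * of_real t)) has_vector_derivative ?g * \<i>) (at t within {\<delta>..T})"
    by (rule has_vector_derivative_real_field)
  have "(\<i> * of_real t) powr complex_of_real p = \<i> powr complex_of_real p * of_real (t powr p)"
    using t assms powr_times_real_left[of "of_real t" \<i> "of_real p"]
    by (simp add: powr_of_real mult.commute)
  moreover have "\<i> powr complex_of_real p * \<i> = exp (\<i> * of_real ((p + 1) * pi / 2))"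
  proof -
    have "\<i> * of_real ((p + 1) * pi / 2) = \<i> * of_real (p * pi / 2) + \<i> * of_real (pi / 2)"
      by (simp add: algebra_simps add_divide_distrib)
    then show ?thesis
      unfolding ii_powr_real by (simp only: exp_add) (simp add: exp_eq_polar)
  qed
  moreover have "exp (\<i> * (\<i> * of_real t)) = of_real (exp (-t))"
    by (simp flip: mult.assoc exp_of_real)
  ultimately have "?g * \<i> = exp (\<i> * of_real ((p + 1) * pi / 2)) * of_real (exp (-t) * t powr p)"
    by (simp add: mult_ac)
  with D show "((\<lambda>t. F (\<i> * of_real t)) has_vector_derivative
      exp (\<i> * of_real ((p + 1) * pi / 2)) * of_real (exp (-t) * t powr p)) (at t within {\<delta>..T})"
    by simp
qed

text \<open>On the straight segment the imaginary part grows linearly, so the exponential has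
  modulus exp (-T u) and can be integrated explicitly. The factor \<open>1 - exp (-T)\<close> is
  kept because the bound serves at both ends: it is at most 1 for large T, and at most T for T near
  0, where it turns T powr p into T powr (p + 1).\<close>

lemma primitive_connecting_segment:
  assumes "T > 0" "p \<le> 0"
  shows "norm (F (\<i> * of_real T) - F (of_real T)) \<le> 2 powr (1 - p) * T powr p * (1 - exp (-T))"
proof -
  \<comment> \<open>The segment from \<open>T\<close> to \<open>\<i> * T\<close>. In
    \<open>C\<close>, the factor \<open>2 * T\<close> bounds the speed and
    \<open>(T / 2) powr p\<close> the power, as every point has modulus at least
    \<open>T / 2\<close> and the exponent is at most 0.\<close>
  define z where "z = (\<lambda>u. of_real T * ((1 - of_real u) + \<i> * of_real u) :: complex)"
  define C where "C = 2 * T * (T / 2) powr p"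
  have pos: "Re (z u) + Im (z u) > 0" if "0 \<le> u" "u \<le> 1" for u
    using that assms by (simp add: z_def algebra_simps)
  have zd: "((\<lambda>u. of_real T * ((1 - u) + \<i> * u)) has_field_derivative of_real T * (\<i> - 1)) (at x)" for x :: complex
    by (auto intro!: derivative_eq_intros)
  have Fd: "((\<lambda>u. F (z u)) has_vector_derivative
      exp (\<i> * z u) * z u powr complex_of_real p * (of_real T * (\<i> - 1))) (at u)" if "0 \<le> u" "u \<le> 1" for u
    unfolding z_def
    by (rule has_vector_derivative_real_field, rule DERIV_chain'[OF zd])
       (use F[OF pos[OF that]] in \<open>simp add: z_def\<close>)
  have half: "T / 2 \<le> norm (z u)" if "0 \<le> u" "u \<le> 1" for u
  proof -
    have "T \<le> \<bar>Re (z u)\<bar> + \<bar>Im (z u)\<bar>"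
      using that assms by (simp add: z_def abs_mult) (simp add: algebra_simps)
    then show ?thesis
      using abs_Re_le_cmod[of "z u"] abs_Im_le_cmod[of "z u"] by linarith
  qed
  have bnd: "norm (exp (\<i> * z u) * z u powr complex_of_real p * (of_real T * (\<i> - 1)))
      \<le> C * exp (- T * u)" if u: "0 \<le> u" "u \<le> 1" for u
  proof -
    have "norm (exp (\<i> * z u)) = exp (- T * u)"
      by (simp add: z_def norm_exp)
    moreover have "norm (z u powr complex_of_real p) \<le> (T / 2) powr p"
    proof -
      have "norm (z u powr complex_of_real p) = norm (z u) powr p"
        using pos[OF u] by (subst norm_powr_real_powr') (auto simp: z_def)
      also have "\<dots> \<le> (T / 2) powr p"
        using half[OF u] assms by (intro powr_mono2') auto
      finally show ?thesis .
    qed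
    moreover have "norm (of_real T * (\<i> - 1)) \<le> 2 * T"
      using assms norm_triangle_ineq4[of \<i> 1] by (simp add: norm_mult)
    ultimately have "norm (exp (\<i> * z u) * z u powr complex_of_real p * (of_real T * (\<i> - 1)))
        \<le> exp (- T * u) * (T / 2) powr p * (2 * T)"
      by (subst norm_mult, subst norm_mult, intro mult_mono) (simp_all add: assms del: norm_mult)
    then show ?thesis by (simp add: C_def mult_ac)
  qed
  \<comment> \<open>The mean value inequality, with a primitive of the majorant
    \<open>C * exp (- T * u)\<close> as comparison function.\<close>
  have "norm (F (z 1) - F (z 0)) \<le> - C / T * exp (- T * 1) - (- C / T * exp (- T * 0))"
  proof (rule differentiable_bound_general[of 0 1 "\<lambda>u. F (z u)" "\<lambda>u. - C / T * exp (- T * u)"])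
    show "continuous_on {0..1} (\<lambda>u. F (z u))"
      by (intro continuous_at_imp_continuous_on ballI has_vector_derivative_continuous[OF Fd]) auto
    show "((\<lambda>u. - C / T * exp (- T * u)) has_vector_derivative C * exp (- T * u)) (at u)" for u
      unfolding has_real_derivative_iff_has_vector_derivative[symmetric]
      using assms by (auto intro!: derivative_eq_intros)
    show "continuous_on {0..1} (\<lambda>u. - C / T * exp (- T * u))"
      by (intro continuous_intros)
  qed (rule zero_less_one Fd bnd; simp)+
  also have "\<dots> = C / T * (1 - exp (-T))"
    by (simp add: right_diff_distrib)
  also have "C / T = 2 powr (1 - p) * T powr p"
    using assms by (simp add: C_def powr_divide powr_diff)
  finally show ?thesis
    by (simp add: z_def mult.commute)
qed

end

lemma absolutely_integrable_continuous_times_powr: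
  fixes g :: "real \<Rightarrow> 'b::euclidean_space" and p T :: real
  assumes p: "-1 < p" and "T \<ge> 0" and g: "continuous_on {0..T} g"
  shows "(\<lambda>t. (t powr p) *\<^sub>R g t) absolutely_integrable_on {0..T}"
proof (rule absolutely_integrable_bounded_measurable_product[of "\<lambda>x r. r *\<^sub>R x" g "{0..T}" "\<lambda>t. t powr p"])
  show "bilinear (\<lambda>(x::'b) (r::real). r *\<^sub>R x)"
    using bounded_bilinear.flip[OF bounded_bilinear_scaleR] by (simp add: bilinear_conv_bounded_bilinear)
  show "bounded (g ` {0..T})"
    by (intro compact_imp_bounded compact_continuous_image g) simp
  have "(\<lambda>t. t powr p) integrable_on {0..T}"
    using integrable_on_powr_from_0[of p T] p \<open>T \<ge> 0\<close> by simp
  then show "(\<lambda>t. t powr p) absolutely_integrable_on {0..T}"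
    by (rule nonnegative_absolutely_integrable_1) simp
qed (use g in \<open>auto intro: continuous_imp_measurable_on_sets_lebesgue\<close>)

lemma integrable_exp_ii_powr:
  fixes p T :: real
  assumes p: "-1 < p" and "T \<ge> 0"
  shows "(\<lambda>t. exp (\<i> * of_real t) * complex_of_real (t powr p)) integrable_on {0..T}"
proof -
  have "continuous_on {0..T} (\<lambda>t. exp (\<i> * complex_of_real t))"
    by (intro continuous_intros)
  from absolutely_integrable_continuous_times_powr[OF assms this] show ?thesis
    by (simp add: scaleR_conv_of_real mult.commute absolutely_integrable_on_def)
qed

text \<open>Both integrals are increments of the same primitive, so over the range from \<delta> to
  T they differ only by the connecting segments at \<delta> and at T. Since p + 1 > 0, the
  contribution at \<delta> vanishes in the limit.\<close>

lemma integral_exp_ii_powr_bound: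
  fixes p T :: real
  assumes p: "-1 < p" "p \<le> 0" and "T > 0"
  shows "norm (integral {0..T} (\<lambda>t. exp (\<i> * of_real t) * of_real (t powr p)) -
           exp (\<i> * of_real ((p + 1) * pi / 2)) * of_real (integral {0..T} (\<lambda>t. exp (-t) * t powr p)))
         \<le> 2 powr (1 - p) * T powr p"
proof -
  let ?A = "\<lambda>t. exp (\<i> * of_real t) * complex_of_real (t powr p)"
  let ?w = "exp (\<i> * complex_of_real ((p + 1) * pi / 2))"
  let ?b = "\<lambda>t. exp (-t) * t powr p"
  let ?c = "2 powr (1 - p)"
  obtain F where F: "\<And>z. Re z + Im z > 0 \<Longrightarrow>
      (F has_field_derivative exp (\<i> * z) * z powr complex_of_real p) (at z)"
    using exp_powr_primitive[of p] by metis
  have Aint: "?A integrable_on {0..T}"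
    by (rule integrable_exp_ii_powr) (use p \<open>T > 0\<close> in auto)
  have "continuous_on {0..T} (\<lambda>t. exp (-t))"
    by (intro continuous_intros)
  from absolutely_integrable_continuous_times_powr[OF p(1) _ this]
  have bint: "?b integrable_on {0..T}"
    using \<open>T > 0\<close> by (simp add: mult.commute absolutely_integrable_on_def)
  define G where "G = (\<lambda>\<delta>. integral {\<delta>..T} ?A - ?w * of_real (integral {\<delta>..T} ?b))"
  have bound: "norm (G \<delta>) \<le> ?c * T powr p + ?c * \<delta> powr (p + 1)" if \<delta>: "0 < \<delta>" "\<delta> \<le> T" for \<delta>
  proof -
    have 1: "integral {\<delta>..T} ?A = F (of_real T) - F (of_real \<delta>)"
      by (rule integral_unique[OF primitive_real_axis[OF F \<delta>]])
    have "integral {\<delta>..T} (\<lambda>t. ?w * of_real (?b t)) = F (\<i> * of_real T) - F (\<i> * of_real \<delta>)"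
      by (rule integral_unique[OF primitive_imaginary_axis[OF F \<delta>]])
    moreover have "?b integrable_on {\<delta>..T}"
      using integrable_subinterval_real[OF bint] \<delta> by auto
    then have "((\<lambda>t. complex_of_real (?b t)) has_integral of_real (integral {\<delta>..T} ?b)) {\<delta>..T}"
      by (intro has_integral_of_real integrable_integral)
    then have "integral {\<delta>..T} (\<lambda>t. ?w * of_real (?b t)) = ?w * of_real (integral {\<delta>..T} ?b)"
      by (intro integral_unique has_integral_mult_right)
    ultimately have 2: "?w * of_real (integral {\<delta>..T} ?b) = F (\<i> * of_real T) - F (\<i> * of_real \<delta>)"
      by simp
    have "norm (F (\<i> * of_real T) - F (of_real T)) \<le> ?c * T powr p * (1 - exp (-T))"
      by (rule primitive_connecting_segment[OF F \<open>T > 0\<close> p(2)])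
    also have "\<dots> \<le> ?c * T powr p * 1"
      by (intro mult_left_mono) auto
    finally have a: "norm (F (\<i> * of_real T) - F (of_real T)) \<le> ?c * T powr p" by simp
    have "norm (F (\<i> * of_real \<delta>) - F (of_real \<delta>)) \<le> ?c * \<delta> powr p * (1 - exp (-\<delta>))"
      by (rule primitive_connecting_segment[OF F \<open>\<delta> > 0\<close> p(2)])
    also have "\<dots> \<le> ?c * \<delta> powr p * \<delta>"
      using exp_ge_add_one_self[of "-\<delta>"] by (intro mult_left_mono) auto
    finally have b: "norm (F (\<i> * of_real \<delta>) - F (of_real \<delta>)) \<le> ?c * \<delta> powr (p + 1)"
      using \<delta> by (simp add: powr_add)
    have "G \<delta> = (F (\<i> * of_real \<delta>) - F (of_real \<delta>)) - (F (\<i> * of_real T) - F (of_real T))"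
      unfolding G_def 1 2 by simp
    then show ?thesis
      using norm_triangle_ineq4[of "F (\<i> * of_real \<delta>) - F (of_real \<delta>)" "F (\<i> * of_real T) - F (of_real T)"] a b
      by simp
  qed
  have "continuous_on {0..T} G"
    unfolding G_def
    by (intro continuous_intros indefinite_integral_continuous_1' Aint bint)
  then have "(G \<longlongrightarrow> G 0) (at 0 within {0..T})"
    using \<open>T > 0\<close> by (simp add: continuous_on_def)
  then have "(G \<longlongrightarrow> G 0) (at_right 0)"
    using at_within_Icc_at_right[OF \<open>T > 0\<close>] by simp
  then have 1: "((\<lambda>\<delta>. norm (G \<delta>)) \<longlongrightarrow> norm (G 0)) (at_right 0)"
    by (rule tendsto_norm)
  have "((\<lambda>\<delta>. \<delta> powr (p + 1)) \<longlongrightarrow> 0 powr (p + 1)) (at_right 0)"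
    using p by (intro tendsto_powr' tendsto_const tendsto_ident_at)
      (auto simp: eventually_at_filter intro!: always_eventually)
  then have 2: "((\<lambda>\<delta>. ?c * T powr p + ?c * \<delta> powr (p + 1)) \<longlongrightarrow> ?c * T powr p + ?c * 0 powr (p + 1)) (at_right 0)"
    by (intro tendsto_add tendsto_mult_left tendsto_const)
  have "\<forall>\<^sub>F \<delta> in at_right 0. norm (G \<delta>) \<le> ?c * T powr p + ?c * \<delta> powr (p + 1)"
    using eventually_at_right_real[OF \<open>T > 0\<close>] by eventually_elim (auto intro: bound)
  then have "norm (G 0) \<le> ?c * T powr p + ?c * 0 powr (p + 1)"
    by (rule tendsto_le[OF trivial_limit_at_right_real 2 1])
  then show ?thesis
    by (simp add: G_def)
qed

text \<open>Scaling t = n y turns the normalised integral into the real part of exp (\<i> \<theta>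
  n) J (n b), where the phase sits in a factor of modulus 1 and J has a limit. The claim is a
  difference tending to 0 because the phases need not converge.\<close>

lemma oscillatory_power_integral_asymptotics:
  fixes p b :: real and \<theta> :: "nat \<Rightarrow> real"
  assumes p: "-1 < p" "p < 0" and "b > 0"
  shows "(\<lambda>n. real n powr (1 + p) * integral {0..b} (\<lambda>y. cos (real n * y + \<theta> n) * y powr p) -
           Gamma (p + 1) * cos (\<theta> n + (p + 1) * pi / 2)) \<longlonglongrightarrow> 0"
proof -
  define J where "J = (\<lambda>T. integral {0..T} (\<lambda>t. exp (\<i> * of_real t) * complex_of_real (t powr p)))"
  define w where "w = exp (\<i> * complex_of_real ((p + 1) * pi / 2))"
  define g where "g = (\<lambda>T. integral {0..T} (\<lambda>t. exp (-t) * t powr p))"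
  have "((\<lambda>T. 2 powr (1 - p) * T powr p) \<longlongrightarrow> 2 powr (1 - p) * 0) at_top"
    by (intro tendsto_mult_left tendsto_neg_powr filterlim_ident) (use p in auto)
  then have "((\<lambda>T. 2 powr (1 - p) * T powr p) \<longlongrightarrow> 0) at_top"
    by simp
  moreover have "\<forall>\<^sub>F T in at_top. norm (J T - w * of_real (g T)) \<le> 2 powr (1 - p) * T powr p"
    using eventually_gt_at_top[of 0] unfolding J_def w_def g_def
    by eventually_elim (use p in \<open>intro integral_exp_ii_powr_bound; simp\<close>)
  ultimately have "((\<lambda>T. J T - w * of_real (g T)) \<longlongrightarrow> 0) at_top"
    by (rule Lim_null_comparison[rotated])
  moreover have "((\<lambda>T. w * of_real (g T)) \<longlongrightarrow> w * of_real (Gamma (p + 1))) at_top"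
    using Gamma_real_limit[of "p + 1"] p by (intro tendsto_intros) (simp add: g_def)
  ultimately have "((\<lambda>T. (J T - w * of_real (g T)) + w * of_real (g T)) \<longlongrightarrow> 0 + w * of_real (Gamma (p + 1))) at_top"
    by (rule tendsto_add)
  then have J: "(J \<longlongrightarrow> w * of_real (Gamma (p + 1))) at_top"
    by simp
  have nb: "filterlim (\<lambda>n. real n * b) at_top sequentially"
    using \<open>b > 0\<close> by (intro filterlim_at_top_mult_tendsto_pos[OF tendsto_const _ filterlim_real_sequentially])
  have lim: "(\<lambda>n. J (real n * b) - w * of_real (Gamma (p + 1))) \<longlonglongrightarrow> 0"
    using filterlim_compose[OF J nb] by (simp add: LIM_zero)
  have eq: "real n powr (1 + p) * integral {0..b} (\<lambda>y. cos (real n * y + \<theta> n) * y powr p) -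
           Gamma (p + 1) * cos (\<theta> n + (p + 1) * pi / 2)
         = Re (exp (\<i> * of_real (\<theta> n)) * (J (real n * b) - w * of_real (Gamma (p + 1))))"
    if "n > 0" for n
  proof -
    let ?e = "exp (\<i> * complex_of_real (\<theta> n))"
    let ?f = "\<lambda>t. cos (t + \<theta> n) * t powr p"
    have "bounded_linear (\<lambda>z. Re (?e * z))"
      by (intro bounded_linear_compose[OF bounded_linear_Re] bounded_linear_mult_right)
    from has_integral_linear[OF integrable_integral[OF integrable_exp_ii_powr] this, of p "real n * b"]
    have "((\<lambda>t. Re (?e * (exp (\<i> * of_real t) * complex_of_real (t powr p))))
            has_integral Re (?e * J (real n * b))) {0..real n * b}"
      using p \<open>b > 0\<close> by (simp add: J_def o_def)
    moreover have "Re (?e * (exp (\<i> * of_real t) * complex_of_real (t powr p))) = ?f t" for t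
      by (simp add: exp_eq_polar cos_add algebra_simps)
    ultimately have "(?f has_integral Re (?e * J (real n * b))) {0..real n * b}"
      by simp
    from has_integral_stretch_real[OF this, of "real n"]
    have "((\<lambda>y. ?f (real n * y)) has_integral (1 / real n) * Re (?e * J (real n * b)))
            ((\<lambda>x. x / real n) ` {0..real n * b})"
      using that by simp
    moreover have "(\<lambda>x. x / real n) ` {0..real n * b} = {0..b}"
      using that \<open>b > 0\<close> by simp
    ultimately have "((\<lambda>y. ?f (real n * y)) has_integral (1 / real n) * Re (?e * J (real n * b))) {0..b}"
      by simp
    then have "integral {0..b} (\<lambda>y. ?f (real n * y)) = (1 / real n) * Re (?e * J (real n * b))"
      by (rule integral_unique)
    moreover have "integral {0..b} (\<lambda>y. ?f (real n * y))
        = integral {0..b} (\<lambda>y. real n powr p * (cos (real n * y + \<theta> n) * y powr p))"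
      by (rule Henstock_Kurzweil_Integration.integral_cong) (simp add: powr_mult)
    ultimately have "real n powr p * integral {0..b} (\<lambda>y. cos (real n * y + \<theta> n) * y powr p)
        = (1 / real n) * Re (?e * J (real n * b))"
      by simp
    then have "real n powr (1 + p) * integral {0..b} (\<lambda>y. cos (real n * y + \<theta> n) * y powr p)
        = Re (?e * J (real n * b))"
      using that by (simp add: powr_add field_simps)
    moreover have "Re (?e * (w * of_real (Gamma (p + 1)))) = Gamma (p + 1) * cos (\<theta> n + (p + 1) * pi / 2)"
      by (simp add: w_def exp_eq_polar cos_add algebra_simps)
    ultimately show ?thesis
      by (simp add: right_diff_distrib)
  qed
  have "(\<lambda>n. Re (exp (\<i> * of_real (\<theta> n)) * (J (real n * b) - w * of_real (Gamma (p + 1))))) \<longlonglongrightarrow> 0"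
  proof (rule Lim_null_comparison[OF _ tendsto_norm_zero[OF lim]])
    show "\<forall>\<^sub>F n in sequentially. norm (Re (exp (\<i> * of_real (\<theta> n)) * (J (real n * b) - w * of_real (Gamma (p + 1)))))
        \<le> norm (J (real n * b) - w * of_real (Gamma (p + 1)))"
      using abs_Re_le_cmod[of "exp (\<i> * of_real (\<theta> _)) * _"]
      by (auto simp: norm_mult intro!: always_eventually order_trans[OF abs_Re_le_cmod] simp del: times_complex.sel)
  qed
  then show ?thesis
    by (rule Lim_transform_eventually) (use eq in \<open>auto intro!: eventually_mono[OF eventually_gt_at_top[of 0]]\<close>)
qed

subsection \<open>Variation of quasi-monotone functions\<close>

lemma zero_in_variation_sums:
  assumes "x \<in> S" shows "0 \<in> variation_sums S g"
proof -
  have "0 = (\<Sum>i<(0::nat). \<bar>g ((\<lambda>_. x) (Suc i)) - g ((\<lambda>_. x) i)\<bar>)"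
    by simp
  then show ?thesis
    unfolding variation_sums_def using assms by fastforce
qed

text \<open>The points \<open>s\<close> and \<open>t\<close> are appended to the partition. Its last
  point may lie below \<open>s\<close>, and the extra jump from there to \<open>s\<close> is
  discarded, hence the inequality.\<close>

lemma variation_sums_extend:
  assumes v: "v \<in> variation_sums {a<..s} g" and s: "a < s" "s \<le> t"
  shows "\<exists>v'\<in>variation_sums {a<..t} g. v + \<bar>g t - g s\<bar> \<le> v'"
proof -
  obtain n p where v: "v = (\<Sum>i<n. \<bar>g (p (Suc i)) - g (p i)\<bar>)"
    and p: "\<And>i. i \<le> n \<Longrightarrow> p i \<in> {a<..s}" and mono: "\<And>i. i < n \<Longrightarrow> p i \<le> p (Suc i)"
    using v unfolding variation_sums_def by blast
  define q where "q = (\<lambda>i. if i \<le> n then p i else if i = Suc n then s else t)"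
  have "(\<Sum>i<n. \<bar>g (q (Suc i)) - g (q i)\<bar>) = v"
    unfolding v by (rule sum.cong) (auto simp: q_def)
  then have "(\<Sum>i<Suc (Suc n). \<bar>g (q (Suc i)) - g (q i)\<bar>) = v + \<bar>g s - g (p n)\<bar> + \<bar>g t - g s\<bar>"
    by (simp add: q_def)
  moreover have "(\<Sum>i<Suc (Suc n). \<bar>g (q (Suc i)) - g (q i)\<bar>) \<in> variation_sums {a<..t} g"
  proof -
    have "q i \<in> {a<..t}" for i
      using p[of i] s by (auto simp: q_def)
    moreover have "q i \<le> q (Suc i)" if "i < Suc (Suc n)" for i
      using that p[of i] mono[of i] s by (cases "i < n"; cases "i = n") (auto simp: q_def)
    ultimately show ?thesis
      unfolding variation_sums_def by blast
  qed
  ultimately show ?thesis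
    by (intro bexI[of _ "\<Sum>i<Suc (Suc n). \<bar>g (q (Suc i)) - g (q i)\<bar>"]) auto
qed

context
  fixes a :: real and L :: "real \<Rightarrow> real"
  assumes bv: "\<And>x. x > a \<Longrightarrow> has_bounded_variation {a<..x} L"
begin

text \<open>The source of the Jordan decomposition: this one inequality says both that the variation
  function V increases and that V - L increases.\<close>

lemma variation_function_increment:
  assumes "a < s" "s \<le> t"
  shows "variation_function a L s + \<bar>L t - L s\<bar> \<le> variation_function a L t"
proof -
  have "v \<le> total_variation {a<..t} L - \<bar>L t - L s\<bar>" if v: "v \<in> variation_sums {a<..s} L" for v
  proof -
    obtain v' where v': "v' \<in> variation_sums {a<..t} L" "v + \<bar>L t - L s\<bar> \<le> v'"
      using variation_sums_extend[OF v assms] by blast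
    have "v' \<le> total_variation {a<..t} L"
      unfolding total_variation_def
      using v' bv[of t] assms by (intro cSup_upper) (auto simp: has_bounded_variation_def)
    with v' show ?thesis by linarith
  qed
  moreover have "variation_sums {a<..s} L \<noteq> {}"
    using zero_in_variation_sums[of s "{a<..s}" L] assms by auto
  ultimately have "total_variation {a<..s} L \<le> total_variation {a<..t} L - \<bar>L t - L s\<bar>"
    unfolding total_variation_def[of "{a<..s}"] by (intro cSup_least) auto
  then show ?thesis
    using assms by (simp add: variation_function_def)
qed

lemma variation_function_nonneg: "0 \<le> variation_function a L t"
proof (cases "t \<le> a")
  case False
  then show ?thesis
    using zero_in_variation_sums[of t "{a<..t}" L] bv[of t]
    by (auto simp: variation_function_def total_variation_def has_bounded_variation_def
        intro: cSup_upper)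
qed (simp add: variation_function_def)

text \<open>Monotonicity on the whole line, as the Stieltjes measure requires; left of
  \<open>a\<close> it rests on the value 0 fixed by the definition.\<close>

lemma mono_variation_function: "mono (variation_function a L)"
proof (rule monoI)
  fix s t :: real assume "s \<le> t"
  show "variation_function a L s \<le> variation_function a L t"
  proof (cases "s \<le> a")
    case True
    then have "variation_function a L s = 0"
      by (simp add: variation_function_def)
    then show ?thesis
      using variation_function_nonneg[of t] by simp
  next
    case False
    then show ?thesis
      using variation_function_increment[of s t] \<open>s \<le> t\<close> by linarith
  qed
qed

end

text \<open>The right limit at x is the infimum of \<open>V\<close> over the points beyond x, and
  all claims follow from that. The sandwich V x \<le> F x \<le> V y for x < y later translates
  masses of the measure back into variation.\<close>

lemma right_limit_mono:
  fixes V :: "real \<Rightarrow> real"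
  assumes "mono V"
  defines "F \<equiv> \<lambda>x. Lim (at_right x) V"
  shows "V x \<le> F x" and "x < y \<Longrightarrow> F x \<le> V y" and "x \<le> y \<Longrightarrow> F x \<le> F y"
    and "continuous (at_right x) F"
proof -
  have F: "F x = Inf (V ` {x<..})" for x
  proof -
    have "(V \<longlongrightarrow> Inf (V ` ({x<..} \<inter> UNIV))) (at x within ({x<..} \<inter> UNIV))"
      by (rule Lim_right_bound[of _ _ _ "V x"]) (use \<open>mono V\<close> in \<open>auto intro: monoD\<close>)
    then show ?thesis
      unfolding F_def by (intro tendsto_Lim) simp_all
  qed
  have bdd: "bdd_below (V ` {x<..})" for x
    by (rule bdd_belowI2[of _ "V x"]) (use \<open>mono V\<close> in \<open>auto intro: monoD\<close>)
  have lower: "V x \<le> F x" for x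
    unfolding F by (rule cInf_greatest) (use \<open>mono V\<close> in \<open>auto intro: monoD\<close>)
  have upper: "F x \<le> V y" if "x < y" for x y
    unfolding F by (rule cInf_lower[OF _ bdd]) (use that in auto)
  have mono: "F x \<le> F y" if "x \<le> y" for x y
    unfolding F by (rule cInf_superset_mono[OF _ bdd]) (use that in auto)
  show "V x \<le> F x" "x < y \<Longrightarrow> F x \<le> V y" "x \<le> y \<Longrightarrow> F x \<le> F y"
    using lower upper mono by auto
  have "(F \<longlongrightarrow> F x) (at_right x)"
  proof (rule order_tendstoI)
    fix c assume "c < F x"
    then show "\<forall>\<^sub>F y in at_right x. c < F y"
      using mono[of x] by (auto simp: eventually_at_filter intro!: always_eventually less_le_trans[of c "F x"])
  next
    fix c assume "F x < c"
    then obtain y where y: "x < y" "V y < c"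
      using cInf_less_iff[OF _ bdd, of x c] unfolding F by auto
    show "\<forall>\<^sub>F z in at_right x. F z < c"
      using eventually_at_right_real[OF y(1)]
    proof eventually_elim
      case (elim z)
      then show ?case using upper[of z y] y by auto
    qed
  qed
  then show "continuous (at_right x) F"
    by (simp add: continuous_within)
qed

text \<open>On the part beyond z the integrand is at least \<open>z powr \<delta>\<close>, and that
  part has mass \<open>F x - F z\<close>; the rest contributes nonnegatively.\<close>

lemma interval_measure_powr_lower_bound:
  fixes F :: "real \<Rightarrow> real"
  assumes F: "\<And>x y. x \<le> y \<Longrightarrow> F x \<le> F y" "\<And>x. continuous (at_right x) F"
    and "0 \<le> a" "a \<le> z" "0 < z" "z \<le> x" "\<delta> > 0"
  shows "z powr \<delta> * (F x - F z) \<le> (LINT u:{a<..x}|interval_measure F. u powr \<delta>)"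
proof -
  let ?m = "interval_measure F"
  have em: "emeasure ?m {s<..x} = ennreal (F x - F s)" if "s \<le> x" for s
    by (rule emeasure_interval_measure_Ioc[OF that F])
  have ind: "integrable ?m (indicator {s<..x} :: real \<Rightarrow> real)" if "s \<le> x" for s
    using em[OF that] by (intro integrable_real_indicator) auto
  have i1: "integrable ?m (\<lambda>u. z powr \<delta> * indicator {z<..x} u)"
    using ind[of z] assms by (intro integrable_mult_right) auto
  \<comment> \<open>Integrability has to be established, because a non-integrable function has
    integral 0, which would void a lower bound.\<close>
  have i2: "integrable ?m (\<lambda>u. indicator {a<..x} u *\<^sub>R u powr \<delta>)"
  proof (rule Bochner_Integration.integrable_bound[of _ "\<lambda>u. x powr \<delta> * indicator {a<..x} u"])
    show "integrable ?m (\<lambda>u. x powr \<delta> * indicator {a<..x} u)"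
      using ind[of a] assms by (intro integrable_mult_right) auto
    show "(\<lambda>u. indicator {a<..x} u *\<^sub>R u powr \<delta>) \<in> borel_measurable ?m"
      by measurable
    show "AE u in ?m. norm (indicator {a<..x} u *\<^sub>R u powr \<delta>) \<le> norm (x powr \<delta> * indicator {a<..x} u)"
      using assms by (intro AE_I2) (auto simp: indicator_def intro!: powr_mono2)
  qed
  have "z powr \<delta> * (F x - F z) = (LINT u|?m. z powr \<delta> * indicator {z<..x} u)"
    using em[of z] F(1)[of z x] assms by (simp add: measure_def)
  also have "\<dots> \<le> (LINT u|?m. indicator {a<..x} u *\<^sub>R u powr \<delta>)"
    using assms by (intro integral_mono i1 i2) (auto simp: indicator_def intro!: powr_mono2)
  finally show ?thesis
    by (simp add: set_lebesgue_integral_def)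
qed

text \<open>The weighted integral over the whole range is localised to its last stretch, where the
  weight is comparable to \<open>x powr \<delta>\<close>. Dividing the weight out leaves the plain
  variation over a dyadic block, bounded by a multiple of L at its right end.\<close>

lemma quasi_monotone_variation_bound:
  assumes qm: "quasi_monotone a L" and pos: "\<And>x. x > a \<Longrightarrow> L x > 0" and "a \<ge> 0"
  obtains C X where "C \<ge> 0" "X > a"
    "\<And>x y. \<lbrakk>X \<le> x; x / 2 \<le> y; y \<le> x\<rbrakk> \<Longrightarrow>
       variation_function a L x - variation_function a L y \<le> C * L x"
proof -
  define V where "V = variation_function a L"
  define F where "F x = Lim (at_right x) V" for x
  obtain \<delta> where "\<delta> > 0" and
    O: "(\<lambda>x. LINT u:{a<..x}|variation_measure a L. u powr \<delta>) \<in> O[at_top](\<lambda>x. x powr \<delta> * L x)"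
    using qm unfolding quasi_monotone_def by blast
  have vm: "variation_measure a L = interval_measure F"
    by (simp add: variation_measure_def F_def[abs_def] V_def)
  have "mono V"
    unfolding V_def using qm by (intro mono_variation_function) (auto simp: quasi_monotone_def)
  note F = right_limit_mono[OF this, folded F_def]
  obtain c where "c > 0" and ev: "\<forall>\<^sub>F x in at_top.
      norm (LINT u:{a<..x}|variation_measure a L. u powr \<delta>) \<le> c * norm (x powr \<delta> * L x)"
    using landau_o.bigE[OF O] by blast
  then obtain X0 where X0: "\<And>x. x \<ge> X0 \<Longrightarrow>
      norm (LINT u:{a<..x}|variation_measure a L. u powr \<delta>) \<le> c * norm (x powr \<delta> * L x)"
    unfolding eventually_at_top_linorder by blast
  \<comment> \<open>\<open>4 * a + 1\<close> ensures that the point \<open>x / 4\<close> chosen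
    below lies beyond \<open>a\<close>.\<close>
  define X where "X = max X0 (4 * a + 1)"
  show thesis
  proof (rule that[of "c * 4 powr \<delta>" X])
    show "0 \<le> c * 4 powr \<delta>" using \<open>c > 0\<close> by simp
    show "X > a" using \<open>a \<ge> 0\<close> by (simp add: X_def)
    fix x y assume xy: "X \<le> x" "x / 2 \<le> y" "y \<le> x"
    have x: "x \<ge> X0" "x > 4 * a" "x > 0" "x > a"
      using xy \<open>a \<ge> 0\<close> by (auto simp: X_def)
    \<comment> \<open>A quarter instead of a half: the right limit at \<open>z\<close> is bounded by
      the variation function at \<open>y\<close> only when z < y, and y may be as small as x /
      2.\<close>
    define z where "z = x / 4"
    have z: "0 < z" "a \<le> z" "z \<le> x" "z < y"
      using x xy by (auto simp: z_def)
    have "z powr \<delta> * (F x - F z) \<le> (LINT u:{a<..x}|interval_measure F. u powr \<delta>)"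
      by (rule interval_measure_powr_lower_bound) (use F z \<open>a \<ge> 0\<close> \<open>\<delta> > 0\<close> in auto)
    also have "\<dots> \<le> c * (x powr \<delta> * L x)"
      using X0[OF x(1)] pos[OF x(4)] unfolding vm by (simp add: abs_mult)
    also have "x powr \<delta> = z powr \<delta> * 4 powr \<delta>"
      using x by (simp add: z_def flip: powr_mult)
    finally have "z powr \<delta> * (F x - F z) \<le> z powr \<delta> * (c * 4 powr \<delta> * L x)"
      by (simp add: mult_ac)
    then have "F x - F z \<le> c * 4 powr \<delta> * L x"
      using z by simp
    then show "variation_function a L x - variation_function a L y \<le> c * 4 powr \<delta> * L x"
      using F(1)[of x] F(2)[OF z(4)] by (simp add: V_def)
  qed
qed

text \<open>The ratio at t = 2 alone is iterated: eventually each doubling multiplies L by less than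
  2 powr \<eta>. Local boundedness supplies the first block, and induction on the number of
  doublings covers the rest.\<close>

lemma slowly_varying_powr_bound:
  assumes sv: "slowly_varying a L" and "\<eta> > 0"
    and bdd: "\<And>x. x > a \<Longrightarrow> \<exists>B. \<forall>y. a < y \<and> y \<le> x \<longrightarrow> L y \<le> B"
  obtains C X where "C \<ge> 0" "X > a" "X > 0" "\<And>x. x \<ge> X \<Longrightarrow> L x \<le> C * x powr \<eta>"
proof -
  have pos: "\<And>x. x > a \<Longrightarrow> L x > 0" and lim: "((\<lambda>x. L (2 * x) / L x) \<longlongrightarrow> 1) at_top"
    using sv by (auto simp: slowly_varying_def)
  have "1 < (2::real) powr \<eta>"
    using \<open>\<eta> > 0\<close> by simp
  then have "\<forall>\<^sub>F x in at_top. L (2 * x) / L x < 2 powr \<eta>"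
    using order_tendstoD(2)[OF lim] by blast
  then obtain X0 where X0: "\<And>x. x \<ge> X0 \<Longrightarrow> L (2 * x) / L x < 2 powr \<eta>"
    unfolding eventually_at_top_linorder by blast
  define X where "X = max X0 (\<bar>a\<bar> + 1)"
  have X: "X \<ge> X0" "X > a" "X > 0"
    by (auto simp: X_def)
  obtain B where B: "\<And>y. a < y \<Longrightarrow> y \<le> 2 * X \<Longrightarrow> L y \<le> B"
    using bdd[of "2 * X"] X by auto
  \<comment> \<open>Normalised at \<open>X\<close>, the left end of the first block, where the
    increasing power is smallest.\<close>
  define C where "C = \<bar>B\<bar> * X powr (-\<eta>)"
  have main: "L x \<le> C * x powr \<eta>" if "X \<le> x" "x \<le> 2 ^ Suc n * X" for x n
    using that
  proof (induction n arbitrary: x)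
    case 0
    have "L x \<le> \<bar>B\<bar>"
      using B[of x] 0 X by simp
    also have "\<dots> = C * X powr \<eta>"
      using X by (simp add: C_def powr_minus)
    also have "\<dots> \<le> C * x powr \<eta>"
      using 0 X \<open>\<eta> > 0\<close> by (intro mult_left_mono powr_mono2) (auto simp: C_def)
    finally show ?case .
  next
    case (Suc n)
    show ?case
    proof (cases "x \<le> 2 * X")
      case True
      also have "2 * X \<le> 2 ^ Suc n * X"
        using X by simp
      finally show ?thesis
        using Suc by blast
    next
      case False
      have "L x \<le> 2 powr \<eta> * L (x / 2)"
        using X0[of "x / 2"] pos[of "x / 2"] False X by (simp add: field_simps)
      also have "\<dots> \<le> 2 powr \<eta> * (C * (x / 2) powr \<eta>)"
        using Suc.prems False by (intro mult_left_mono Suc.IH) simp_all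
      also have "\<dots> = C * x powr \<eta>"
        using False X by (simp add: powr_divide)
      finally show ?thesis .
    qed
  qed
  show thesis
  proof (rule that[of C X])
    fix x assume "x \<ge> X"
    obtain n where "x / X < 2 ^ n"
      using real_arch_pow[of 2 "x / X"] by auto
    then have "x \<le> 2 ^ n * X"
      using X by (simp add: field_simps)
    also have "\<dots> \<le> 2 ^ Suc n * X"
      using X by simp
    finally show "L x \<le> C * x powr \<eta>"
      using main \<open>x \<ge> X\<close> by blast
  qed (use X in \<open>auto simp: C_def\<close>)
qed

lemma le_add_variation_function:
  assumes bv: "\<And>x. x > a \<Longrightarrow> has_bounded_variation {a<..x} L" and "a < y" "y \<le> x"
  shows "L y \<le> L x + variation_function a L x"
  using variation_function_increment[OF bv, of y x] variation_function_nonneg[OF bv, of y] assms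
  by force

text \<open>Extends the bounds from a neighbourhood of infinity to the whole half line, since the
  oscillatory estimates run up to y = 1 / a. On the remaining range L and its variation are bounded,
  and \<open>x powr \<eta>\<close> is at least \<open>a powr \<eta>\<close>.\<close>

lemma quasi_monotone_powr_bounds:
  fixes L :: "real \<Rightarrow> real"
  assumes qm: "quasi_monotone a L" and pos: "\<And>x. x > a \<Longrightarrow> L x > 0" and "a > 0" "\<eta> \<ge> 0"
    and growth: "\<forall>\<^sub>F x in at_top. L x \<le> G * x powr \<eta>"
  obtains C where "C \<ge> 0" "\<And>x. x > a \<Longrightarrow> L x \<le> C * x powr \<eta>"
    "\<And>x y. \<lbrakk>a < y; x / 2 \<le> y; y \<le> x\<rbrakk> \<Longrightarrow>
       variation_function a L x - variation_function a L y \<le> C * x powr \<eta>"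
proof -
  define V where "V = variation_function a L"
  have bv: "\<And>x. x > a \<Longrightarrow> has_bounded_variation {a<..x} L"
    using qm by (simp add: quasi_monotone_def)
  have V: "mono V" "\<And>x. V x \<ge> 0"
    unfolding V_def by (rule mono_variation_function[OF bv]; simp) (rule variation_function_nonneg[OF bv]; simp)
  have small: "M \<le> M * a powr (-\<eta>) * x powr \<eta>" if "x > a" "M \<ge> 0" for x M
  proof -
    have "a powr \<eta> \<le> x powr \<eta>"
      using that \<open>a > 0\<close> \<open>\<eta> \<ge> 0\<close> by (intro powr_mono2) auto
    then have "1 \<le> a powr (-\<eta>) * x powr \<eta>"
      using \<open>a > 0\<close> by (simp add: powr_minus field_simps)
    from mult_left_mono[OF this \<open>M \<ge> 0\<close>] show ?thesis
      by (simp add: mult.assoc)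
  qed
  obtain X0 where X0: "\<And>x. x \<ge> X0 \<Longrightarrow> L x \<le> G * x powr \<eta>"
    using growth unfolding eventually_at_top_linorder by blast
  obtain C1 X1 where C1: "C1 \<ge> 0" "X1 > a" "\<And>x y. \<lbrakk>X1 \<le> x; x / 2 \<le> y; y \<le> x\<rbrakk> \<Longrightarrow>
       V x - V y \<le> C1 * L x"
    by (rule quasi_monotone_variation_bound[OF qm pos]) (use \<open>a > 0\<close> in \<open>auto simp: V_def\<close>)
  define X where "X = max X0 X1"
  have X: "X \<ge> X0" "X \<ge> X1" "X > a"
    using C1 by (auto simp: X_def)
  \<comment> \<open>\<open>L X + V X\<close> dominates both L and the variation on the range up to
    \<open>X\<close>; the factor \<open>a powr (-\<eta>)\<close> converts a constant into a multiple
    of \<open>x powr \<eta>\<close>.\<close>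
  define M where "M = (L X + V X) * a powr (-\<eta>)"
  have "M \<ge> 0"
    using V(2)[of X] pos[of X] X by (simp add: M_def)
  define C2 where "C2 = \<bar>G\<bar> + M"
  have "C2 \<ge> 0"
    using \<open>M \<ge> 0\<close> by (simp add: C2_def)
  have L: "L x \<le> C2 * x powr \<eta>" if "x > a" for x
  proof (cases "x \<le> X")
    case True
    have "L x \<le> L X + V X"
      using le_add_variation_function[OF bv that True] by (simp add: V_def)
    also have "\<dots> \<le> M * x powr \<eta>"
      unfolding M_def using that V(2)[of X] pos[of X] X by (intro small) auto
    also have "\<dots> \<le> C2 * x powr \<eta>"
      by (intro mult_right_mono) (auto simp: C2_def)
    finally show ?thesis .
  next
    case False
    have "L x \<le> G * x powr \<eta>"
      using False X by (intro X0) auto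
    also have "\<dots> \<le> C2 * x powr \<eta>"
      using \<open>M \<ge> 0\<close> by (intro mult_right_mono) (auto simp: C2_def)
    finally show ?thesis .
  qed
  have VV: "V x - V y \<le> (M + C1 * C2) * x powr \<eta>" if "a < y" "x / 2 \<le> y" "y \<le> x" for x y
  proof (cases "x \<le> X")
    case True
    have "V x - V y \<le> L X + V X"
      using V(2)[of y] monoD[OF V(1) True] pos[of X] X by auto
    also have "\<dots> \<le> M * x powr \<eta>"
      unfolding M_def using that V(2)[of X] pos[of X] X by (intro small) auto
    also have "\<dots> \<le> (M + C1 * C2) * x powr \<eta>"
      using \<open>C1 \<ge> 0\<close> \<open>C2 \<ge> 0\<close> by (intro mult_right_mono) auto
    finally show ?thesis .
  next
    case False
    have "V x - V y \<le> C1 * L x"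
      using False X that by (intro C1) auto
    also have "\<dots> \<le> C1 * (C2 * x powr \<eta>)"
      using that C1 by (intro mult_left_mono L) auto
    also have "\<dots> \<le> (M + C1 * C2) * x powr \<eta>"
      using \<open>M \<ge> 0\<close> by (simp add: algebra_simps)
    finally show ?thesis .
  qed
  define C where "C = C2 + (M + C1 * C2)"
  have C: "C \<ge> 0" "C2 \<le> C" "M + C1 * C2 \<le> C"
    using \<open>M \<ge> 0\<close> \<open>C1 \<ge> 0\<close> \<open>C2 \<ge> 0\<close> by (auto simp: C_def)
  show thesis
  proof (rule that[OF C(1)])
    show "L x \<le> C * x powr \<eta>" if "x > a" for x
      using L[OF that] mult_right_mono[OF C(2), of "x powr \<eta>"] by simp
    show "variation_function a L x - variation_function a L y \<le> C * x powr \<eta>"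
      if "a < y" "x / 2 \<le> y" "y \<le> x" for x y
      using VV[OF that] mult_right_mono[OF C(3), of "x powr \<eta>"] by (simp add: V_def)
  qed
qed

text \<open>The substitution x = 1 / y maps dyadic blocks at infinity to dyadic blocks at 0 and
  reverses monotonicity, so V (1 / y) and V (1 / y) - L (1 / y) + c decrease in y. Their difference
  is the required factor.\<close>

lemma quasi_monotone_oscillatory_little_o:
  fixes L :: "real \<Rightarrow> real" and \<theta> :: "nat \<Rightarrow> real"
  assumes qm: "quasi_monotone a L" and pos: "\<And>x. x > a \<Longrightarrow> L x > 0" and "a > 0" "\<eta> \<ge> 0"
    and growth: "\<forall>\<^sub>F x in at_top. L x \<le> G * x powr \<eta>"
    and p: "p \<le> 0" and \<alpha>: "0 < \<eta> - p" "\<eta> - p < 1"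
    and int: "(\<lambda>y. (L (1 / y) - c) * y powr p) absolutely_integrable_on {0..1 / a}"
    and lim: "((\<lambda>y. (L (1 / y) - c) * y powr \<eta>) \<longlongrightarrow> 0) (at_right 0)"
  shows "(\<lambda>n. real n powr (1 + p - \<eta>) *
           integral {0..1 / a} (\<lambda>y. cos (real n * y + \<theta> n) * (L (1 / y) - c) * y powr p)) \<longlonglongrightarrow> 0"
proof -
  define V where "V = variation_function a L"
  have bv: "\<And>x. x > a \<Longrightarrow> has_bounded_variation {a<..x} L"
    using qm by (simp add: quasi_monotone_def)
  have V: "V s + \<bar>L t - L s\<bar> \<le> V t" if "a < s" "s \<le> t" for s t
    unfolding V_def by (rule variation_function_increment[OF bv that])
  obtain C where C: "C \<ge> 0" "\<And>x. x > a \<Longrightarrow> L x \<le> C * x powr \<eta>"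
    "\<And>x y. \<lbrakk>a < y; x / 2 \<le> y; y \<le> x\<rbrakk> \<Longrightarrow> V x - V y \<le> C * x powr \<eta>"
    unfolding V_def by (rule quasi_monotone_powr_bounds[OF qm pos \<open>a > 0\<close> \<open>\<eta> \<ge> 0\<close> growth]) auto
  \<comment> \<open>One \<open>C\<close> bounds the drop of V; the drop of V - L + c may add the
    value L (1 / y), hence a second. The last term absorbs the constant \<open>c\<close>, because
    \<open>(a * y) powr \<eta>\<close> is at most 1.\<close>
  define D where "D = 2 * C + \<bar>c\<bar> * a powr (-\<eta>)"
  have D: "D \<ge> 0" "C \<le> D" "2 * C \<le> D"
    using C(1) by (auto simp: D_def)
  have inv: "1 / y > a" if "0 < y" "y < 1 / a" for y
    using that \<open>a > 0\<close> by (simp add: field_simps)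
  have invp: "(1 / y) powr \<eta> = y powr (-\<eta>)" if "y > 0" for y :: real
    using that by (simp add: powr_divide powr_minus_divide)
  show ?thesis
  proof (rule oscillatory_integral_little_o[of p \<eta> D "1 / a" _ "\<lambda>y. V (1 / y)" "\<lambda>y. V (1 / y) - L (1 / y) + c"])
    fix x y :: real
    assume xy: "0 < x" "x \<le> y" "y < 1 / a"
    then have le: "1 / y \<le> 1 / x" "a < 1 / y" "a < 1 / x"
      using inv[of y] inv[of x] by (auto simp: frac_le)
    from V[OF le(2,1)]
    show "V (1 / y) \<le> V (1 / x)" "V (1 / y) - L (1 / y) + c \<le> V (1 / x) - L (1 / x) + c"
      by linarith+
    assume "y \<le> 2 * x"
    then have half: "(1 / x) / 2 \<le> 1 / y"
      using xy by (simp add: field_simps)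
    have 1: "V (1 / x) - V (1 / y) \<le> C * x powr (-\<eta>)"
      using C(3)[OF le(2) half le(1)] invp[of x] xy by simp
    also have "\<dots> \<le> D * x powr (-\<eta>)"
      using D by (intro mult_right_mono) auto
    finally show "V (1 / x) - V (1 / y) \<le> D * x powr (-\<eta>)" .
    have "L (1 / y) \<le> C * y powr (-\<eta>)"
      using C(2)[OF le(2)] invp[of y] xy by simp
    also have "\<dots> \<le> C * x powr (-\<eta>)"
      using C xy \<open>\<eta> \<ge> 0\<close> by (intro mult_left_mono powr_mono2') auto
    finally have "V (1 / x) - L (1 / x) + c - (V (1 / y) - L (1 / y) + c) \<le> 2 * C * x powr (-\<eta>)"
      using 1 pos[OF le(3)] by linarith
    also have "\<dots> \<le> D * x powr (-\<eta>)"
      using D by (intro mult_right_mono) auto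
    finally show "V (1 / x) - L (1 / x) + c - (V (1 / y) - L (1 / y) + c) \<le> D * x powr (-\<eta>)" .
  next
    fix y :: real assume y: "0 < y" "y < 1 / a"
    have "L (1 / y) \<le> C * y powr (-\<eta>)" "0 < L (1 / y)"
      using C(2)[OF inv[OF y]] pos[OF inv[OF y]] invp[of y] y by simp_all
    moreover have "\<bar>c\<bar> \<le> \<bar>c\<bar> * a powr (-\<eta>) * y powr (-\<eta>)"
    proof -
      have "(a * y) powr \<eta> \<le> 1"
        using y \<open>a > 0\<close> \<open>\<eta> \<ge> 0\<close> by (intro powr_le1) (auto simp: field_simps)
      then have "1 \<le> a powr (-\<eta>) * y powr (-\<eta>)"
        using y \<open>a > 0\<close> by (simp add: powr_mult powr_minus field_simps)
      from mult_left_mono[OF this, of "\<bar>c\<bar>"] show ?thesis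
        by (simp add: mult.assoc)
    qed
    moreover have "0 \<le> C * y powr (-\<eta>)"
      using C(1) by simp
    ultimately show "\<bar>L (1 / y) - c\<bar> \<le> D * y powr (-\<eta>)"
      unfolding D_def distrib_right by linarith
  next
    fix h \<theta> :: real
    have "continuous_on {0..1 / a} (\<lambda>y. cos (h * y + \<theta>))"
      by (intro continuous_intros)
    then have "(\<lambda>y. cos (h * y + \<theta>) * ((L (1 / y) - c) * y powr p)) absolutely_integrable_on {0..1 / a}"
      by (intro absolutely_integrable_bounded_measurable_product_real int
          continuous_imp_measurable_on_sets_lebesgue compact_imp_bounded compact_continuous_image) auto
    then show "(\<lambda>y. cos (h * y + \<theta>) * (L (1 / y) - c) * y powr p) integrable_on {0..1 / a}"
      by (simp add: absolutely_integrable_on_def mult.assoc)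
  qed (use p \<alpha> D lim \<open>a > 0\<close> in auto)
qed

subsection \<open>Reduction to the distance from the singularity\<close>

lemma integral_shift_reflect:
  fixes g :: "real \<Rightarrow> real"
  assumes "g integrable_on {p..q}"
  shows "((\<lambda>y. g (p + y)) has_integral integral {p..q} g) {0..q - p}"
    and "((\<lambda>y. g (q - y)) has_integral integral {p..q} g) {0..q - p}"
proof -
  have I: "(g has_integral integral {p..q} g) (cbox p q)"
    using assms by (simp add: integrable_integral)
  have 1: "(\<lambda>x. x - p) ` {p..q} = {0..q - p}"
    by (simp add: image_minus_const_atLeastAtMost')
  have 2: "(\<lambda>x. q - x) ` {p..q} = {0..q - p}"
    by simp
  show "((\<lambda>y. g (p + y)) has_integral integral {p..q} g) {0..q - p}"
    using has_integral_affinity[OF I, of 1 p] 1 by (simp add: add.commute)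
  show "((\<lambda>y. g (q - y)) has_integral integral {p..q} g) {0..q - p}"
    using has_integral_affinity[OF I, of "-1" q] 2 by simp
qed

lemma absolutely_integrable_shift_reflect:
  fixes g :: "real \<Rightarrow> real"
  assumes "g absolutely_integrable_on {p..q}"
  shows "(\<lambda>y. g (p + y)) absolutely_integrable_on {0..q - p}"
    and "(\<lambda>y. g (q - y)) absolutely_integrable_on {0..q - p}"
  using assms integral_shift_reflect[of g p q] integral_shift_reflect[of "\<lambda>x. \<bar>g x\<bar>" p q]
  unfolding absolutely_integrable_on_def by (auto intro: has_integral_integrable)

lemma integral_even:
  fixes g :: "real \<Rightarrow> real"
  assumes "c \<ge> 0" and int: "g integrable_on {-c..c}"
    and even: "\<And>x. \<bar>x\<bar> < c \<Longrightarrow> g (-x) = g x"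
  shows "integral {-c..c} g = 2 * integral {0..c} g"
proof -
  have "integral {-c..0} g = integral {-c..0} (\<lambda>x. g (-x))"
    by (rule integral_spike[of "{-c}"]) (use even in auto)
  also have "\<dots> = integral {0..c} g"
    using Henstock_Kurzweil_Integration.integral_reflect_real[of c 0 g] by (simp only: minus_zero)
  finally have "integral {-c..0} g = integral {0..c} g" .
  then show ?thesis
    using Henstock_Kurzweil_Integration.integral_combine[OF _ _ int, of 0] \<open>c \<ge> 0\<close> by simp
qed

section \<open>From the spectral density to a cosine integral\<close>

lemma spectral_density_absolutely_integrable:
  assumes "spectral_density M X f"
  shows "f absolutely_integrable_on {-pi..pi}"
proof -
  have "set_integrable lborel {-pi<..<pi} f"
    using assms by (simp add: spectral_density_def)
  then have "set_integrable lebesgue {-pi<..<pi} f"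
    unfolding set_integrable_def by (subst integrable_completion) auto
  then show ?thesis
    using absolutely_integrable_on_open_interval[of "-pi" pi f] by simp
qed

text \<open>The autocovariance is real, so taking real parts of the spectral representation leaves
  the cosine, and evenness folds the interval. The resulting 2 is the one in the constant of the
  theorem.\<close>

lemma autocovariance_eq_cosine_integral:
  assumes sd: "spectral_density M X f"
  shows "autocovariance M X h = 2 * integral {0..pi} (\<lambda>x. cos (of_int h * x) * f x)"
proof -
  let ?S = "{-pi<..<pi} :: real set"
  let ?e = "\<lambda>x. exp (\<i> * of_int h * complex_of_real x) * complex_of_real (f x)"
  have f: "integrable lborel (\<lambda>x. indicator ?S x * f x)"
    and even: "\<And>x. x \<in> ?S \<Longrightarrow> f (-x) = f x"
    and eq: "complex_of_real (autocovariance M X h) = (LINT x:?S|lborel. ?e x)"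
    using sd by (auto simp: spectral_density_def set_integrable_def)
  have ie: "set_integrable lborel ?S ?e"
    unfolding set_integrable_def
  proof (rule Bochner_Integration.integrable_bound[OF f])
    \<comment> \<open>The density is known to be measurable only on the interval, so the indicator
      stays attached to it.\<close>
    have "(\<lambda>x. exp (\<i> * of_int h * complex_of_real x) * complex_of_real (indicator ?S x * f x)) \<in> borel_measurable lborel"
      using borel_measurable_integrable[OF f] by measurable
    moreover have "(\<lambda>x. exp (\<i> * of_int h * complex_of_real x) * complex_of_real (indicator ?S x * f x))
        = (\<lambda>x. indicator ?S x *\<^sub>R ?e x)"
      by (auto simp: indicator_def)
    ultimately show "(\<lambda>x. indicator ?S x *\<^sub>R ?e x) \<in> borel_measurable lborel"
      by simp
  qed (auto simp: norm_mult indicator_def)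
  have Re: "Re (?e x) = cos (of_int h * x) * f x" for x
    by (simp add: Re_exp)
  have "autocovariance M X h = Re (LINT x:?S|lborel. ?e x)"
    using eq by (metis Re_complex_of_real)
  also have "\<dots> = Re (integral ?S ?e)"
    by (simp only: set_borel_integral_eq_integral(2)[OF ie])
  also have "\<dots> = integral ?S (\<lambda>x. cos (of_int h * x) * f x)"
    using has_integral_linear[OF integrable_integral[OF set_borel_integral_eq_integral(1)[OF ie]] bounded_linear_Re]
    by (simp only: o_def Re) (simp only: integral_unique)
  also have "\<dots> = integral {-pi..pi} (\<lambda>x. cos (of_int h * x) * f x)"
    by (simp add: integral_open_interval_real)
  also have "\<dots> = 2 * integral {0..pi} (\<lambda>x. cos (of_int h * x) * f x)"
  proof (rule integral_even)
    have "continuous_on {-pi..pi} (\<lambda>x. cos (of_int h * x))"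
      by (intro continuous_intros)
    then have "(\<lambda>x. cos (of_int h * x) * f x) absolutely_integrable_on {-pi..pi}"
      by (intro absolutely_integrable_bounded_measurable_product_real
          spectral_density_absolutely_integrable[OF sd]
          continuous_imp_measurable_on_sets_lebesgue compact_imp_bounded compact_continuous_image) auto
    then show "(\<lambda>x. cos (of_int h * x) * f x) integrable_on {-pi..pi}"
      by (simp add: absolutely_integrable_on_def)
    show "cos (of_int h * - x) * f (- x) = cos (of_int h * x) * f x" if "\<bar>x\<bar> < pi" for x
      using even[of x] that by (simp add: abs_less_iff)
  qed simp
  finally show ?thesis .
qed

section \<open>Asymptotics of the autocovariance\<close>

theorem propositionB3:
  fixes M :: "'a measure"
    and X :: "int \<Rightarrow> 'a \<Rightarrow> real"
    and f_X R_minus R_plus L_minus L_plus :: "real \<Rightarrow> real"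
    and lambda0 d \<epsilon> c_minus c_plus :: real
  assumes stationary: "second_order_stationary M X"
    and density: "spectral_density M X f_X"
    and lambda0_range: "0 < lambda0" "lambda0 < pi"
    and d: "0 < d" "d < 1/2"
    and f_left: "\<And>x. 0 < x \<Longrightarrow> x < lambda0 \<Longrightarrow>
      f_X x = (c_minus + R_minus (lambda0 - x)) * (lambda0 - x) powr (- 2 * d)"
    and f_right: "\<And>x. lambda0 < x \<Longrightarrow> x < pi \<Longrightarrow>
      f_X x = (c_plus + R_plus (x - lambda0)) * (x - lambda0) powr (- 2 * d)"
    and c_plus: "c_plus > 0"
    and c_minus: "c_minus = 0"
    and eps: "0 < \<epsilon>" "\<epsilon> < d"
    and R_minus: "\<And>x. 0 < x \<Longrightarrow> x < lambda0 \<Longrightarrow> R_minus x = L_minus (1 / x) * x powr (2 * \<epsilon>)"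
    and R_plus: "\<And>x. 0 < x \<Longrightarrow> x < pi - lambda0 \<Longrightarrow> R_plus x = L_plus (1 / x) - c_plus"
    and L_minus: "slowly_varying (1 / lambda0) L_minus" "quasi_monotone (1 / lambda0) L_minus"
    and L_plus: "slowly_varying (1 / (pi - lambda0)) L_plus"
      "quasi_monotone (1 / (pi - lambda0)) L_plus"
    and L_plus_lim: "(L_plus \<longlongrightarrow> c_plus) at_top"
  shows "let c_gamma = 2 * Gamma (1 - 2 * d) * c_plus; phi = (1/2 - d) * pi
    in \<exists>R_gamma :: nat \<Rightarrow> real.
      (\<forall>h\<ge>1. autocovariance M X (int h) =
         (c_gamma * cos (lambda0 * real h + phi) + R_gamma h) * real h powr (2 * d - 1)) \<and>
      R_gamma \<longlonglongrightarrow> 0"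
proof -
  define a1 a2 where "a1 = 1 / lambda0" and "a2 = 1 / (pi - lambda0)"
  have a: "a1 > 0" "a2 > 0" "1 / a1 = lambda0" "1 / a2 = pi - lambda0"
    using lambda0_range by (auto simp: a1_def a2_def)
  \<comment> \<open>The total power of the distance on the left of \<open>lambda0\<close>. With
    \<eta> = 2 \<epsilon> the normalising exponent 1 + p - \<eta> is 1 - 2 d, the same as on the
    right.\<close>
  define p where "p = 2 * \<epsilon> - 2 * d"
  have fa: "f_X absolutely_integrable_on {-pi..pi}"
    by (rule spectral_density_absolutely_integrable[OF density])
  have f1: "f_X absolutely_integrable_on {0..lambda0}" and f2: "f_X absolutely_integrable_on {lambda0..pi}"
    by (rule absolutely_integrable_on_subinterval[OF fa]; use lambda0_range in auto)+
  \<comment> \<open>The subtracted 0 puts the left factor into the form L (1 / y) - c shared with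
    the right side.\<close>
  have minus: "f_X (lambda0 - y) = (L_minus (1 / y) - 0) * y powr p" if "0 < y" "y < lambda0" for y
    using f_left[of "lambda0 - y"] R_minus[of y] that c_minus powr_add[of y "2 * \<epsilon>" "-2 * d"]
    by (simp add: p_def)
  have plus: "f_X (lambda0 + y) = (L_plus (1 / y) - c_plus) * y powr (-2 * d) + c_plus * y powr (-2 * d)"
    if "0 < y" "y < pi - lambda0" for y
    using f_right[of "lambda0 + y"] R_plus[of y] that by (simp add: algebra_simps)
  have inv_lim: "filterlim (\<lambda>y. 1 / y) at_top (at_right (0::real))"
    using filterlim_inverse_at_top_right by (simp add: inverse_eq_divide)

  \<comment> \<open>\<open>A\<close> and \<open>B\<close> are the remainders on the left and right,
    \<open>P\<close> is the pure power. The phases have opposite signs because on the left the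
    frequency is \<open>lambda0 - y\<close>.\<close>
  define A where "A n = integral {0..lambda0}
    (\<lambda>y. cos (real n * y + (- (real n * lambda0))) * (L_minus (1 / y) - 0) * y powr p)" for n
  define B where "B n = integral {0..pi - lambda0}
    (\<lambda>y. cos (real n * y + real n * lambda0) * (L_plus (1 / y) - c_plus) * y powr (-2 * d))" for n
  define P where "P n = integral {0..pi - lambda0}
    (\<lambda>y. cos (real n * y + real n * lambda0) * y powr (-2 * d))" for n

  \<comment> \<open>Integrability is inherited from the density. The endpoints are excepted, since
    the formula for the density holds only inside the interval.\<close>
  have int_minus: "(\<lambda>y. (L_minus (1 / y) - 0) * y powr p) absolutely_integrable_on {0..lambda0}"
  proof (rule absolutely_integrable_spike[where f = "\<lambda>y. f_X (lambda0 - y)" and S = "{0, lambda0}"])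
    show "(\<lambda>y. f_X (lambda0 - y)) absolutely_integrable_on {0..lambda0}"
      using absolutely_integrable_shift_reflect(2)[OF f1] by simp
  qed (use minus in auto)
  have int_power: "(\<lambda>y. c_plus * y powr (-2 * d)) absolutely_integrable_on {0..pi - lambda0}"
    using absolutely_integrable_continuous_times_powr[of "-2 * d" "pi - lambda0" "\<lambda>_. c_plus"]
      d lambda0_range by (simp add: mult.commute)
  have int_plus: "(\<lambda>y. (L_plus (1 / y) - c_plus) * y powr (-2 * d)) absolutely_integrable_on {0..pi - lambda0}"
  proof (rule absolutely_integrable_spike[where S = "{0, pi - lambda0}" and
      f = "\<lambda>y. f_X (lambda0 + y) - c_plus * y powr (-2 * d)"])
    show "(\<lambda>y. f_X (lambda0 + y) - c_plus * y powr (-2 * d)) absolutely_integrable_on {0..pi - lambda0}"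
      using absolutely_integrable_shift_reflect(1)[OF f2] int_power by (rule set_integral_diff(1))
  qed (use plus in auto)

  have A_lim: "(\<lambda>n. real n powr (1 - 2 * d) * A n) \<longlonglongrightarrow> 0"
  proof -
    have pos: "\<And>x. x > a1 \<Longrightarrow> L_minus x > 0"
      using L_minus(1) by (simp add: slowly_varying_def a1_def)
    have qm: "quasi_monotone a1 L_minus"
      using L_minus(2) by (simp add: a1_def)
    have bv: "\<And>x. x > a1 \<Longrightarrow> has_bounded_variation {a1<..x} L_minus"
      using qm by (simp add: quasi_monotone_def)
    have bdd: "\<exists>B. \<forall>y. a1 < y \<and> y \<le> x \<longrightarrow> L_minus y \<le> B" for x
      using le_add_variation_function[OF bv] by blast
    \<comment> \<open>Growth of order \<epsilon>, half of \<eta>, leaves a factor y powr \<epsilon>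
      to spare, which forces the limit 0 required below.\<close>
    obtain C X where "C \<ge> 0" "X > 0" and C: "\<And>x. x \<ge> X \<Longrightarrow> L_minus x \<le> C * x powr \<epsilon>"
      using slowly_varying_powr_bound[OF L_minus(1) eps(1)] bdd unfolding a1_def by metis
    have "\<forall>\<^sub>F x in at_top. L_minus x \<le> C * x powr (2 * \<epsilon>)"
      using eventually_ge_at_top[of X] eventually_ge_at_top[of 1]
    proof eventually_elim
      case (elim x)
      have "C * x powr \<epsilon> \<le> C * x powr (2 * \<epsilon>)"
        using elim eps \<open>C \<ge> 0\<close> by (intro mult_left_mono powr_mono) auto
      with C[of x] elim show ?case by linarith
    qed
    moreover have "((\<lambda>y. (L_minus (1 / y) - 0) * y powr (2 * \<epsilon>)) \<longlongrightarrow> 0) (at_right 0)"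
    proof (rule Lim_null_comparison)
      have "((\<lambda>x. C * x powr (-\<epsilon>)) \<longlongrightarrow> C * 0) at_top"
        by (intro tendsto_mult_left tendsto_neg_powr filterlim_ident) (use eps in auto)
      from filterlim_compose[OF this inv_lim]
      show "((\<lambda>y. C * (1 / y) powr (-\<epsilon>)) \<longlongrightarrow> 0) (at_right 0)"
        by simp
      show "\<forall>\<^sub>F y in at_right 0. norm ((L_minus (1 / y) - 0) * y powr (2 * \<epsilon>)) \<le> C * (1 / y) powr (-\<epsilon>)"
        using eventually_at_right_less[of 0]
          inv_lim[unfolded filterlim_at_top, rule_format, of "max X (a1 + 1)"]
      proof eventually_elim
        case (elim y)
        then have "L_minus (1 / y) > 0" "L_minus (1 / y) \<le> C * (1 / y) powr \<epsilon>"
          using pos[of "1 / y"] C[of "1 / y"] by auto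
        then have "norm ((L_minus (1 / y) - 0) * y powr (2 * \<epsilon>)) \<le> C * (1 / y) powr \<epsilon> * y powr (2 * \<epsilon>)"
          by (simp add: abs_mult mult_right_mono)
        also have "\<dots> = C * (1 / y) powr (-\<epsilon>)"
          using elim powr_add[of y \<epsilon> \<epsilon>] by (simp add: powr_divide powr_minus_divide)
        finally show ?case .
      qed
    qed
    ultimately show ?thesis
      using quasi_monotone_oscillatory_little_o[OF qm pos a(1), of "2 * \<epsilon>" C p 0 "\<lambda>n. - (real n * lambda0)"]
        eps d int_minus a(3) by (simp add: A_def p_def)
  qed

  have B_lim: "(\<lambda>n. real n powr (1 - 2 * d) * B n) \<longlonglongrightarrow> 0"
  proof -
    have pos: "\<And>x. x > a2 \<Longrightarrow> L_plus x > 0"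
      using L_plus(1) by (simp add: slowly_varying_def a2_def)
    have qm: "quasi_monotone a2 L_plus"
      using L_plus(2) by (simp add: a2_def)
    have "\<forall>\<^sub>F x in at_top. L_plus x < c_plus + 1"
      using L_plus_lim by (rule order_tendstoD) simp
    \<comment> \<open>Here \<eta> = 0, so the growth condition is mere boundedness. The factor
      \<open>x powr 0\<close> is 1 only away from x = 0.\<close>
    then have growth: "\<forall>\<^sub>F x in at_top. L_plus x \<le> (c_plus + 1) * x powr 0"
      using eventually_gt_at_top[of 0] by eventually_elim simp
    have "((\<lambda>y. L_plus (1 / y) - c_plus) \<longlongrightarrow> 0) (at_right 0)"
      using filterlim_compose[OF L_plus_lim inv_lim] by (simp add: LIM_zero)
    then have lim: "((\<lambda>y. (L_plus (1 / y) - c_plus) * y powr 0) \<longlongrightarrow> 0) (at_right 0)"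
      by (rule Lim_transform_eventually) (auto simp: eventually_at_filter)
    show ?thesis
      using quasi_monotone_oscillatory_little_o[OF qm pos a(2) _ growth, of "-2 * d" c_plus "\<lambda>n. real n * lambda0"]
        lim d int_plus a(4) by (simp add: B_def)
  qed

  have P_lim: "(\<lambda>n. real n powr (1 - 2 * d) * P n -
      Gamma (1 - 2 * d) * cos (real n * lambda0 + (1 - 2 * d) * pi / 2)) \<longlonglongrightarrow> 0"
    using oscillatory_power_integral_asymptotics[of "-2 * d" "pi - lambda0" "\<lambda>n. real n * lambda0"] d lambda0_range
    by (simp add: P_def)

  have cos_int: "(\<lambda>x. cos (t * x + u) * g x) absolutely_integrable_on {r..s}"
    if "g absolutely_integrable_on {r..s}" for t u r s and g :: "real \<Rightarrow> real"
  proof -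
    have "continuous_on {r..s} (\<lambda>x. cos (t * x + u))"
      by (intro continuous_intros)
    with that show ?thesis
      by (intro absolutely_integrable_bounded_measurable_product_real
          continuous_imp_measurable_on_sets_lebesgue compact_imp_bounded compact_continuous_image) auto
  qed

  have acov: "autocovariance M X (int n) = 2 * (A n + B n + c_plus * P n)" for n
  proof -
    let ?g = "\<lambda>x. cos (real n * x) * f_X x"
    have g: "?g integrable_on {0..lambda0}" "?g integrable_on {lambda0..pi}"
      using cos_int[OF f1, of "real n" 0] cos_int[OF f2, of "real n" 0] by (auto simp: absolutely_integrable_on_def)
    have "integral {0..pi} ?g = integral {0..lambda0} ?g + integral {lambda0..pi} ?g"
      using Henstock_Kurzweil_Integration.integral_combine[of 0 lambda0 pi ?g]
        Henstock_Kurzweil_Integration.integrable_combine[of 0 lambda0 pi ?g] g lambda0_range by simp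
    moreover have "integral {0..lambda0} ?g = A n"
    proof -
      have "integral {0..lambda0} ?g = integral {0..lambda0} (\<lambda>y. ?g (lambda0 - y))"
        using integral_shift_reflect(2)[OF g(1)] by (simp add: integral_unique)
      also have "\<dots> = A n"
        unfolding A_def
      proof (rule integral_spike[of "{0, lambda0}"])
        fix y assume "y \<in> {0..lambda0} - {0, lambda0}"
        then have y: "0 < y" "y < lambda0" by auto
        have "cos (real n * y + - (real n * lambda0)) = cos (real n * (lambda0 - y))"
          by (subst cos_minus[symmetric]) (simp add: algebra_simps)
        then show "cos (real n * y + - (real n * lambda0)) * (L_minus (1 / y) - 0) * y powr p = ?g (lambda0 - y)"
          unfolding minus[OF y] by (simp add: mult.assoc)
      qed simp
      finally show ?thesis .
    qed
    moreover have "integral {lambda0..pi} ?g = B n + c_plus * P n"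
    proof -
      let ?b = "\<lambda>y. cos (real n * y + real n * lambda0) * (L_plus (1 / y) - c_plus) * y powr (-2 * d)"
      let ?p = "\<lambda>y. cos (real n * y + real n * lambda0) * y powr (-2 * d)"
      have bi: "?b integrable_on {0..pi - lambda0}"
        using cos_int[OF int_plus] by (simp add: absolutely_integrable_on_def mult.assoc)
      have "(\<lambda>y. y powr (-2 * d)) absolutely_integrable_on {0..pi - lambda0}"
        using absolutely_integrable_continuous_times_powr[of "-2 * d" "pi - lambda0" "\<lambda>_. 1 :: real"]
          d lambda0_range by simp
      then have pi: "?p integrable_on {0..pi - lambda0}"
        using cos_int by (simp add: absolutely_integrable_on_def)
      have "integral {lambda0..pi} ?g = integral {0..pi - lambda0} (\<lambda>y. ?g (lambda0 + y))"
        using integral_shift_reflect(1)[OF g(2)] by (simp add: integral_unique)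
      also have "\<dots> = integral {0..pi - lambda0} (\<lambda>y. ?b y + c_plus * ?p y)"
      proof (rule integral_spike[of "{0, pi - lambda0}"])
        fix y assume "y \<in> {0..pi - lambda0} - {0, pi - lambda0}"
        then have y: "0 < y" "y < pi - lambda0" by auto
        show "?b y + c_plus * ?p y = ?g (lambda0 + y)"
          unfolding plus[OF y] by (simp add: algebra_simps)
      qed simp
      also have "\<dots> = B n + c_plus * P n"
        unfolding B_def P_def
        by (intro integral_unique has_integral_add has_integral_mult_right integrable_integral bi pi)
      finally show ?thesis .
    qed
    ultimately show ?thesis
      using autocovariance_eq_cosine_integral[OF density, of "int n"] by simp
  qed

  \<comment> \<open>Chosen so that the main term plus \<open>R n\<close> is
    \<open>real n powr (1 - 2 * d)\<close> times the autocovariance; the subtracted cosine is the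
    main term without its factor \<open>2 * c_plus\<close>.\<close>
  define R where "R n = 2 * (real n powr (1 - 2 * d) * A n) + 2 * (real n powr (1 - 2 * d) * B n) +
    2 * c_plus * (real n powr (1 - 2 * d) * P n -
      Gamma (1 - 2 * d) * cos (real n * lambda0 + (1 - 2 * d) * pi / 2))" for n
  have "R \<longlonglongrightarrow> 2 * 0 + 2 * 0 + 2 * c_plus * 0"
    unfolding R_def by (intro tendsto_add tendsto_mult_left A_lim B_lim P_lim)
  then have "R \<longlonglongrightarrow> 0"
    by simp
  moreover have "autocovariance M X (int h) =
      (2 * Gamma (1 - 2 * d) * c_plus * cos (lambda0 * real h + (1/2 - d) * pi) + R h) * real h powr (2 * d - 1)"
    if "h \<ge> 1" for h
  proof -
    have phase: "lambda0 * real h + (1/2 - d) * pi = real h * lambda0 + (1 - 2 * d) * pi / 2"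
      by (simp add: field_simps)
    have "2 * Gamma (1 - 2 * d) * c_plus * cos (lambda0 * real h + (1/2 - d) * pi) + R h
        = real h powr (1 - 2 * d) * autocovariance M X (int h)"
      unfolding R_def acov phase
      by (simp only: distrib_left right_diff_distrib mult_ac)
    \<comment> \<open>The cancellation uses h \<ge> 1, as both powers are 0 at h = 0.\<close>
    moreover have "real h powr (1 - 2 * d) * real h powr (2 * d - 1) = 1"
      using that by (simp flip: powr_add)
    ultimately show ?thesis
      by (metis mult.assoc mult.commute mult.right_neutral)
  qed
  ultimately show ?thesis
    unfolding Let_def by blast
qed

end
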